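(* Let $A\in\mathbb{C}^{m\times n}$, $A\neq O$. The following properties hold. (i) $\mathrm{sol}(A,\mathbf{0})=\mathrm{sol}_\theta(A,\mathbf{0})$ for all $\theta\in\big(0,\|A^\dagger\|_2^{-1}\big)$. (ii) Let $\theta>0$ be such that $\mathrm{sol}_\theta(A,\mathbf{0})$ is well-defined (and $A_\theta\ne O$). Then for every $\Delta A\in\mathbb{C}^{m\times n}$ satisfying $$\|\Delta A\|_2<\min\Big\{\tfrac12\big(\|A_\theta^\dagger\|_2^{-1}-\|A-A_\theta\|_2\big),\ \theta-\|A-A_\theta\|_2,\ \|A_\theta^\dagger\|_2^{-1}-\theta\Big\},$$ the numerical solution $\mathrm{sol}_\theta(A+\Delta A,\mathbf{0})$ uniquely exists in the same Grassmannian as $\mathrm{sol}_\theta(A,\mathbf{0})$ and $$\mathrm{dist}\big(\mathrm{sol}_\theta(A+\Delta A,\mathbf{0}),\,\mathrm{sol}_\theta(A,\mathbf{0})\big)\le \frac{\|A_\theta\|_2\,\|A_\theta^\dagger\|_2}{1-\|A_\theta^\dagger\|_2\,(\|A-A_\theta\|_2+\|\Delta A\|_2)}\,\frac{\|\Delta A\|_2}{\|A\|_2}.$$ (iii) For any $\Delta A\in\mathbb{C}^{m\times n}$ with $\|\Delta A\|_2<\frac12\|A^\dagger\|_2^{-1}$, there exist $\mu\ge 0$ and $\eta>0$ with $$\mu\le\|\Delta A\|_2<\|A^\dagger\|_2^{-1}-\|\Delta A\|_2\le\eta$$ such that, for every $\theta\in(\mu,\eta)$, the numerical solution $\mathrm{sol}_\theta(A+\Delta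 A,\mathbf{0})$ is in the same Grassmannian as the exact solution $\mathrm{sol}(A,\mathbf{0})$ and $$\mathrm{dist}\big(\mathrm{sol}_\theta(A+\Delta A,\mathbf{0}),\,\mathrm{sol}(A,\mathbf{0})\big)\le\frac{\|A\|_2\,\|A^\dagger\|_2}{1-\|A^\dagger\|_2\,\|\Delta A\|_2}\,\frac{\|\Delta A\|_2}{\|A\|_2}.$$
   Context: For a matrix $G\in\mathbb{C}^{m\times n}$, $\sigma_j(G)$ is the $j$-th largest singular value, $\|G\|_2$ the spectral norm, and $G^\dagger$ the Moore-Penrose inverse; for $G\ne O$ of rank $r$, $\|G^\dagger\|_2^{-1}=\sigma_r(G)$ is the smallest positive singular value. Let $G=\sum_j\sigma_j(G)\,\mathbf{u}_j\mathbf{v}_j^{H}$ be a singular value decomposition. For $\theta>0$ not equal to a singular value of $G$, the numerical rank within $\theta$ is $\mathrm{rank}_\theta(G)=\#\{j:\sigma_j(G)>\theta\}$, and the $\theta$-projection of $G$ is $G_\theta=\sum_{\sigma_j(G)>\theta}\sigma_j(G)\,\mathbf{u}_j\mathbf{v}_j^{H}$; both are undefined if $\theta$ is a singular value of $G$. $\mathrm{sol}(G,\mathbf{0})=\ker G=\{\mathbf{u}\in\mathbb{C}^n: G\mathbf{u}=\mathbf{0}\}$. The numerical solution of $G\mathbf{x}=\mathbf{0}$ within $\theta$ is $\mathrm{sol}_\theta(G,\mathbf{0}):=\ker(G_\theta)$, an element of the Grassmannian $\mathcal{G}_{n-r}(\mathbb{C}^n)$ with $r=\mathrm{rank}_\theta(G)$;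 it is well-defined if and only if $\theta$ is not a singular value of $G$. The Grassmannian $\mathcal{G}_k(\mathbb{C}^n)$ is the set of $k$-dimensional subspaces of $\mathbb{C}^n$ with the metric $\mathrm{dist}(\mathcal{P},\mathcal{Q})=\|PP^{H}-QQ^{H}\|_2$, where the columns of $P$ and $Q$ form orthonormal bases of $\mathcal{P}$ and $\mathcal{Q}$ ($(\cdot)^{H}$ is the conjugate transpose). *)

theory Defs
  imports "HOL-Analysis.Analysis"
begin

definition cinner :: "complex^'n \<Rightarrow> complex^'n \<Rightarrow> complex" where
  "cinner x y = (\<Sum>i\<in>UNIV. cnj (x $ i) * y $ i)"

definition conj_transpose :: "complex^'n^'m \<Rightarrow> complex^'m^'n" where
  "conj_transpose A = (\<chi> i j. cnj (A $ j $ i))"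

definition outer :: "complex^'m \<Rightarrow> complex^'n \<Rightarrow> complex^'n^'m" where
  "outer u v = (\<chi> i j. u $ i * cnj (v $ j))"

definition orthonormal_on :: "nat set \<Rightarrow> (nat \<Rightarrow> complex^'n) \<Rightarrow> bool" where
  "orthonormal_on I u \<longleftrightarrow> (\<forall>i\<in>I. \<forall>j\<in>I. cinner (u i) (u j) = (if i = j then 1 else 0))"

text \<open>The norm of the type of matrices is the Frobenius norm, hence the operator norm here.\<close>

definition spectral_norm :: "complex^'n^'m \<Rightarrow> real" where
  "spectral_norm A = onorm ((*v) A)"

definition is_pinv :: "complex^'n^'m \<Rightarrow> complex^'m^'n \<Rightarrow> bool" where
  "is_pinv A X \<longleftrightarrow> A ** X ** A = A \<and> X ** A ** X = X \<and>
     conj_transpose (A ** X) = A ** X \<and> conj_transpose (X ** A) = X ** A"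

definition pinv :: "complex^'n^'m \<Rightarrow> complex^'m^'n" where
  "pinv A = (THE X. is_pinv A X)"

text \<open>An \<open>m \<times> n\<close> matrix has \<open>min m n\<close> singular values, counted with multiplicity and indexed
  from 1 in decreasing order; zero singular values are included.\<close>

definition sv_index :: "complex^'n^'m \<Rightarrow> nat set" where
  "sv_index (G :: complex^'n^'m) = {1..min CARD('m) CARD('n)}"

definition is_svd ::
    "complex^'n^'m \<Rightarrow> (nat \<Rightarrow> real) \<Rightarrow> (nat \<Rightarrow> complex^'m) \<Rightarrow> (nat \<Rightarrow> complex^'n) \<Rightarrow> bool" where
  "is_svd G \<sigma> u v \<longleftrightarrow>
     (\<forall>j\<in>sv_index G. 0 \<le> \<sigma> j) \<and>
     (\<forall>i\<in>sv_index G. \<forall>j\<in>sv_index G. i \<le> j \<longrightarrow> \<sigma> j \<le> \<sigma> i) \<and>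
     orthonormal_on (sv_index G) u \<and> orthonormal_on (sv_index G) v \<and>
     G = (\<Sum>j\<in>sv_index G. \<sigma> j *\<^sub>R outer (u j) (v j))"

definition singular_value :: "complex^'n^'m \<Rightarrow> nat \<Rightarrow> real" where
  "singular_value G j = (THE s. \<exists>\<sigma> u v. is_svd G \<sigma> u v \<and> s = \<sigma> j)"

definition singular_values :: "complex^'n^'m \<Rightarrow> real set" where
  "singular_values G = singular_value G ` sv_index G"

definition numerical_rank :: "real \<Rightarrow> complex^'n^'m \<Rightarrow> nat" where
  "numerical_rank \<theta> G = card {j \<in> sv_index G. singular_value G j > \<theta>}"

text \<open>The projection and the numerical solution are first given as relations, so that
  well-definedness (existence, and independence of the chosen decomposition) can be stated.\<close>

definition is_theta_projection :: "real \<Rightarrow> complex^'n^'m \<Rightarrow> complex^'n^'m \<Rightarrow> bool" where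
  "is_theta_projection \<theta> G H \<longleftrightarrow> \<theta> > 0 \<and> \<theta> \<notin> singular_values G \<and>
     (\<exists>\<sigma> u v. is_svd G \<sigma> u v \<and>
        H = (\<Sum>j\<in>{j \<in> sv_index G. \<sigma> j > \<theta>}. \<sigma> j *\<^sub>R outer (u j) (v j)))"

definition theta_projection :: "real \<Rightarrow> complex^'n^'m \<Rightarrow> complex^'n^'m" where
  "theta_projection \<theta> G = (THE H. is_theta_projection \<theta> G H)"

definition sol :: "complex^'n^'m \<Rightarrow> (complex^'n) set" where
  "sol G = {x. G *v x = 0}"

definition is_num_sol :: "real \<Rightarrow> complex^'n^'m \<Rightarrow> (complex^'n) set \<Rightarrow> bool" where
  "is_num_sol \<theta> G S \<longleftrightarrow> (\<exists>H. is_theta_projection \<theta> G H \<and> S = sol H)"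

definition num_sol_well_defined :: "real \<Rightarrow> complex^'n^'m \<Rightarrow> bool" where
  "num_sol_well_defined \<theta> G \<longleftrightarrow> (\<exists>!S. is_num_sol \<theta> G S)"

definition num_sol :: "real \<Rightarrow> complex^'n^'m \<Rightarrow> (complex^'n) set" where
  "num_sol \<theta> G = (THE S. is_num_sol \<theta> G S)"

definition grassmannian :: "nat \<Rightarrow> (complex^'n) set set" where
  "grassmannian k = {S. vec.subspace S \<and> vec.dim S = k}"

text \<open>If the columns \<open>p 1, \<dots>, p k\<close> of a matrix \<open>P\<close> form an orthonormal basis of \<open>S\<close>, then the sum
  below is \<open>P P\<^sup>H\<close>.\<close>

definition is_projector :: "(complex^'n) set \<Rightarrow> complex^'n^'n \<Rightarrow> bool" where
  "is_projector S M \<longleftrightarrow> (\<exists>k p. orthonormal_on {1..k} p \<and> vec.span (p ` {1..k}) = S \<and>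
     M = (\<Sum>j\<in>{1..k}. outer (p j) (p j)))"

definition projector :: "(complex^'n) set \<Rightarrow> complex^'n^'n" where
  "projector S = (THE M. is_projector S M)"

definition gdist :: "(complex^'n) set \<Rightarrow> (complex^'n) set \<Rightarrow> real" where
  "gdist S T = spectral_norm (projector S - projector T)"

end

theory Submission
  imports Defs
begin

text \<open>
  Write \<open>P\<close> for the orthogonal projector onto the span of the right singular vectors of \<open>A\<close>
  whose singular values exceed \<open>\<theta>\<close>, and \<open>P'\<close> for the analogous projector of \<open>A + \<Delta>A\<close>. The
  numerical solutions are the ranges of \<open>1 - P\<close> and \<open>1 - P'\<close>, so their distance is
  \<open>\<parallel>P - P'\<parallel>\<close>, and everything rests on two classical perturbation bounds for a singular value
  decomposition.

  Weyl's inequality (lemma \<open>weyl_inequality\<close>) says that a perturbation \<open>\<Delta>A\<close> moves every singular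
  value by at most \<open>\<parallel>\<Delta>A\<parallel>\<close>. Let \<open>\<alpha>\<close> be the smallest singular value of \<open>A\<close> above \<open>\<theta>\<close> and
  \<open>\<beta> = \<parallel>A - A\<^sub>\<theta>\<parallel>\<close> the largest one below (zero if there is none). The hypotheses on \<open>\<Delta>A\<close> give
  \<open>\<beta> + \<parallel>\<Delta>A\<parallel> < \<theta> < \<alpha> - \<parallel>\<Delta>A\<parallel>\<close>: no singular value reaches or crosses \<open>\<theta>\<close>, hence the numerical
  rank stays the same, and the singular values of \<open>A\<close> on one side of \<open>\<theta>\<close> are separated from those
  of \<open>A + \<Delta>A\<close> on the other side by the gap \<open>g = \<alpha> - \<beta> - \<parallel>\<Delta>A\<parallel>\<close>.

  Wedin's theorem (lemma \<open>wedin\<close>) turns such a gap into the bounds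
  \<open>\<parallel>P (1 - P')\<parallel> \<le> \<parallel>\<Delta>A\<parallel> / g\<close> and \<open>\<parallel>P' (1 - P)\<parallel> \<le> \<parallel>\<Delta>A\<parallel> / g\<close>. Both together
  control \<open>\<parallel>P - P'\<parallel>\<close>, because \<open>P - P' = P (1 - P') - (1 - P) P'\<close> and the two terms have orthogonal
  ranges. Since \<open>\<parallel>A\<^sub>\<theta>\<parallel> = \<parallel>A\<parallel>\<close> and \<open>\<parallel>A\<^sub>\<theta>\<^sup>\<dagger>\<parallel> = 1 / \<alpha>\<close>, the bound in the theorem is just
  \<open>\<parallel>\<Delta>A\<parallel> / g\<close>.

  The same two results with \<open>\<Delta>A = 0\<close> show that the singular values, and the projector of any cutoff,
  do not depend on the chosen decomposition, which is what makes \<open>A\<^sub>\<theta>\<close> and the numerical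
  solution well-defined. Part (iii) is part (ii) for a \<open>\<theta>\<close> below the smallest positive singular
  value, where \<open>A\<^sub>\<theta> = A\<close> by part (i), with the largest admissible \<open>\<mu> = \<parallel>\<Delta>A\<parallel>\<close> and the
  smallest admissible \<open>\<eta> = \<parallel>A\<^sup>\<dagger>\<parallel>\<^sup>-\<^sup>1 - \<parallel>\<Delta>A\<parallel>\<close>.
\<close>

(* Index sets are intervals {1..r}; without this, the simplifier turns them into {Suc 0..r}. *)
declare One_nat_def [simp del]

section \<open>The Hermitian inner product and the spectral norm\<close>

lemma cinner_add_right: "cinner x (y + z) = cinner x y + cinner x z"
  and cinner_diff_right: "cinner x (y - z) = cinner x y - cinner x z"
  and cinner_scale_right: "cinner x (c *s y) = c * cinner x y"
  and cinner_zero_left [simp]: "cinner 0 y = 0"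
  and cinner_zero_right [simp]: "cinner x 0 = 0"
  by (simp_all add: cinner_def sum.distrib sum_subtractf sum_distrib_left algebra_simps)

lemma cinner_sum_right: "cinner x (\<Sum>j\<in>I. f j) = (\<Sum>j\<in>I. cinner x (f j))"
  by (induction I rule: infinite_finite_induct) (auto simp: cinner_add_right)

lemma cnj_cinner: "cnj (cinner x y) = cinner y x"
  by (simp add: cinner_def mult.commute)

text \<open>The norm of \<open>complex^'n\<close> comes from its real inner product, which is the real part of the
  Hermitian one; this links norms to the complex notion of orthogonality.\<close>

lemma Re_cinner: "Re (cinner x y) = x \<bullet> y"
  by (simp add: cinner_def inner_vec_def inner_complex_def)

lemma cinner_self: "cinner x x = of_real ((norm x)\<^sup>2)"
proof -
  have "Im (cinner x x) = 0"
    by (simp add: cinner_def)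
  moreover have "Re (cinner x x) = (norm x)\<^sup>2"
    by (simp add: Re_cinner power2_norm_eq_inner)
  ultimately show ?thesis
    by (simp add: complex_eq_iff)
qed

lemma cinner_adjoint: "cinner (A *v x) y = cinner x (conj_transpose A *v y)"
proof -
  have "cinner (A *v x) y = (\<Sum>i\<in>UNIV. \<Sum>j\<in>UNIV. cnj (A $ i $ j) * cnj (x $ j) * y $ i)"
    by (simp add: cinner_def matrix_vector_mult_def sum_distrib_right)
  also have "\<dots> = (\<Sum>j\<in>UNIV. \<Sum>i\<in>UNIV. cnj (A $ i $ j) * cnj (x $ j) * y $ i)"
    by (rule sum.swap)
  also have "\<dots> = cinner x (conj_transpose A *v y)"
    by (simp add: cinner_def matrix_vector_mult_def conj_transpose_def sum_distrib_left mult_ac)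
  finally show ?thesis .
qed

lemma inner_adjoint: "(A *v x) \<bullet> y = x \<bullet> (conj_transpose A *v y)"
  for A :: "complex^'n^'m"
  by (metis Re_cinner cinner_adjoint)

lemma conj_transpose_conj_transpose [simp]: "conj_transpose (conj_transpose A) = A"
  and conj_transpose_diff: "conj_transpose (A - B) = conj_transpose A - conj_transpose B"
  and conj_transpose_mat_1 [simp]: "conj_transpose (mat 1) = mat 1"
  by (simp_all add: conj_transpose_def vec_eq_iff mat_def)

lemma conj_transpose_mult: "conj_transpose (A ** B) = conj_transpose B ** conj_transpose A"
  by (simp add: conj_transpose_def matrix_matrix_mult_def vec_eq_iff mult.commute)

lemma conj_transpose_scaleR: "conj_transpose (c *\<^sub>R A) = c *\<^sub>R conj_transpose A"
  by (simp add: conj_transpose_def vec_eq_iff)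

lemma conj_transpose_sum: "conj_transpose (\<Sum>j\<in>I. f j) = (\<Sum>j\<in>I. conj_transpose (f j))"
  by (simp add: conj_transpose_def vec_eq_iff)

lemma matrix_sub_ldistrib: "A ** (B - C) = A ** B - A ** C"
  and matrix_sub_rdistrib: "(B - C) ** D = B ** D - C ** D"
  for A :: "complex^'n^'m" and B C :: "complex^'k^'n" and D :: "complex^'l^'k"
  by (simp_all add: matrix_matrix_mult_def vec_eq_iff sum_subtractf algebra_simps)

lemma norm_mult_vec_le: "norm (A *v x) \<le> spectral_norm A * norm x"
  unfolding spectral_norm_def by (rule onorm) simp

lemma spectral_norm_leI: "(\<And>x. norm (A *v x) \<le> c * norm x) \<Longrightarrow> spectral_norm A \<le> c"
  unfolding spectral_norm_def by (rule onorm_le)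

lemma spectral_norm_nonneg: "0 \<le> spectral_norm A"
  unfolding spectral_norm_def by (rule onorm_pos_le) simp

lemma spectral_norm_eq_0: "spectral_norm A = 0 \<longleftrightarrow> A = 0"
  unfolding spectral_norm_def by (subst onorm_eq_0) (auto simp: matrix_eq)

lemma spectral_norm_mult: "spectral_norm (A ** B) \<le> spectral_norm A * spectral_norm B"
proof (rule spectral_norm_leI)
  fix x
  have "norm ((A ** B) *v x) \<le> spectral_norm A * norm (B *v x)"
    by (metis matrix_vector_mul_assoc norm_mult_vec_le)
  also have "\<dots> \<le> spectral_norm A * (spectral_norm B * norm x)"
    by (intro mult_left_mono norm_mult_vec_le spectral_norm_nonneg)
  finally show "norm ((A ** B) *v x) \<le> spectral_norm A * spectral_norm B * norm x"
    by simp
qed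

lemma spectral_norm_triangle: "spectral_norm (A + B) \<le> spectral_norm A + spectral_norm B"
proof (rule spectral_norm_leI)
  fix x
  have "norm ((A + B) *v x) \<le> norm (A *v x) + norm (B *v x)"
    by (metis matrix_vector_mult_add_rdistrib norm_triangle_ineq)
  also have "\<dots> \<le> (spectral_norm A + spectral_norm B) * norm x"
    using norm_mult_vec_le[of A x] norm_mult_vec_le[of B x] by (simp add: algebra_simps)
  finally show "norm ((A + B) *v x) \<le> (spectral_norm A + spectral_norm B) * norm x" .
qed

lemma spectral_norm_minus_commute: "spectral_norm (A - B) = spectral_norm (B - A)"
  unfolding spectral_norm_def
  by (simp add: matrix_vector_mult_diff_rdistrib onorm_def norm_minus_commute)

lemma spectral_norm_conj_transpose_le: "spectral_norm (conj_transpose A) \<le> spectral_norm A"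
proof (rule spectral_norm_leI)
  fix x
  let ?y = "conj_transpose A *v x"
  have "(norm ?y)\<^sup>2 = x \<bullet> (A *v ?y)"
    by (metis power2_norm_eq_inner inner_adjoint conj_transpose_conj_transpose)
  also have "\<dots> \<le> norm x * (spectral_norm A * norm ?y)"
    by (intro order_trans[OF norm_cauchy_schwarz] mult_left_mono norm_mult_vec_le) simp
  finally show "norm ?y \<le> spectral_norm A * norm x"
    by (cases "?y = 0") (simp_all add: power2_eq_square spectral_norm_nonneg mult_ac)
qed

lemma spectral_norm_conj_transpose: "spectral_norm (conj_transpose A) = spectral_norm A"
  by (metis order_antisym conj_transpose_conj_transpose spectral_norm_conj_transpose_le)

section \<open>Sums of dyads of orthonormal vectors\<close>

text \<open>A singular value decomposition, its truncations, their adjoints and pseudoinverses, and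
  orthogonal projectors all have this form, and it is closed under adjoints and products as long as
  the inner vectors belong to one orthonormal family (lemma \<open>dyads_mult\<close>). The identities between
  these matrices thereby reduce to identities between index sets and coefficients.\<close>

definition dyads :: "nat set \<Rightarrow> (nat \<Rightarrow> real) \<Rightarrow> (nat \<Rightarrow> complex^'m) \<Rightarrow> (nat \<Rightarrow> complex^'n) \<Rightarrow>
    complex^'n^'m" where
  "dyads I s u v = (\<Sum>j\<in>I. s j *\<^sub>R outer (u j) (v j))"

abbreviation orthoproj :: "nat set \<Rightarrow> (nat \<Rightarrow> complex^'n) \<Rightarrow> complex^'n^'n" where
  "orthoproj I v \<equiv> dyads I (\<lambda>_. 1) v v"

lemma outer_mult_vec: "outer u v *v x = cinner v x *s u"
  by (simp add: outer_def cinner_def matrix_vector_mult_def vec_eq_iff sum_distrib_right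
      sum_distrib_left mult_ac)

lemma dyads_mult_vec:
  "dyads I s u v *v x = (\<Sum>j\<in>I. (of_real (s j) * cinner (v j) x) *s u j)"
proof -
  have "(s j *\<^sub>R outer (u j) (v j)) *v x = (of_real (s j) * cinner (v j) x) *s u j" for j
  proof -
    have "(s j *\<^sub>R outer (u j) (v j)) *v x = s j *\<^sub>R (outer (u j) (v j) *v x)"
      by (simp add: matrix_vector_mult_def vec_eq_iff scaleR_sum_right)
    then show ?thesis
      by (simp add: outer_mult_vec vec_eq_iff scaleR_conv_of_real[where 'a = complex])
  qed
  then show ?thesis
    unfolding dyads_def
    by (induction I rule: infinite_finite_induct) (auto simp: matrix_vector_mult_add_rdistrib)
qed

lemma conj_transpose_outer: "conj_transpose (outer u v) = outer v u"
  by (simp add: conj_transpose_def outer_def vec_eq_iff mult.commute)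

lemma conj_transpose_dyads: "conj_transpose (dyads I s u v) = dyads I s v u"
  unfolding dyads_def by (simp add: conj_transpose_sum conj_transpose_scaleR conj_transpose_outer)

lemma dyads_cong:
  "\<lbrakk>\<And>j. j \<in> I \<Longrightarrow> s j = s' j; \<And>j. j \<in> I \<Longrightarrow> u j = u' j; \<And>j. j \<in> I \<Longrightarrow> v j = v' j\<rbrakk>
    \<Longrightarrow> dyads I s u v = dyads I s' u' v'"
  unfolding dyads_def by (intro sum.cong) auto

lemma dyads_diff:
  assumes "finite I" "J \<subseteq> I"
  shows "dyads I s u v - dyads J s u v = dyads (I - J) s u v"
  unfolding dyads_def using assms by (simp add: sum_diff)

lemma orthonormal_on_subset: "orthonormal_on I v \<Longrightarrow> J \<subseteq> I \<Longrightarrow> orthonormal_on J v"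
  unfolding orthonormal_on_def by blast

lemma orthonormal_onD: "orthonormal_on I v \<Longrightarrow> i \<in> I \<Longrightarrow> j \<in> I \<Longrightarrow>
    cinner (v i) (v j) = (if i = j then 1 else 0)"
  by (auto simp: orthonormal_on_def)

lemma cinner_dyads:
  assumes "orthonormal_on I u" "finite I" "K \<subseteq> I" "i \<in> I"
  shows "cinner (u i) (dyads K s u v *v x) =
    (if i \<in> K then of_real (s i) * cinner (v i) x else 0)"
proof -
  have "finite K"
    using assms finite_subset by blast
  have "cinner (u i) (dyads K s u v *v x) =
      (\<Sum>j\<in>K. if i = j then of_real (s j) * cinner (v j) x else 0)"
    unfolding dyads_mult_vec cinner_sum_right
    by (intro sum.cong) (use assms in \<open>auto simp: cinner_scale_right orthonormal_on_def\<close>)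
  also have "\<dots> = (if i \<in> K then of_real (s i) * cinner (v i) x else 0)"
    using \<open>finite K\<close> by simp
  finally show ?thesis .
qed

lemma dyads_mult:
  assumes "orthonormal_on I v" "finite I" "J \<subseteq> I" "K \<subseteq> I"
  shows "dyads J s u v ** dyads K t v w = dyads (J \<inter> K) (\<lambda>j. s j * t j) u w"
proof -
  have "finite J"
    using assms finite_subset by blast
  have "(dyads J s u v ** dyads K t v w) *v x = dyads (J \<inter> K) (\<lambda>j. s j * t j) u w *v x" for x
  proof -
    have "dyads J s u v *v (dyads K t v w *v x) =
        (\<Sum>j\<in>J. if j \<in> K then (of_real (s j * t j) * cinner (w j) x) *s u j else 0)"
      unfolding dyads_mult_vec[of J]
      by (intro sum.cong)
        (use assms in \<open>auto simp: cinner_dyads[OF assms(1,2,4)] mult.assoc subset_iff\<close>)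
    also have "\<dots> = dyads (J \<inter> K) (\<lambda>j. s j * t j) u w *v x"
      unfolding dyads_mult_vec sum.inter_restrict[OF \<open>finite J\<close>] by (intro sum.cong) auto
    finally show ?thesis
      by (simp add: matrix_vector_mul_assoc)
  qed
  then show ?thesis
    by (simp add: matrix_eq)
qed

lemma norm_dyads_sq:
  assumes "orthonormal_on I u" "finite I"
  shows "(norm (dyads I s u v *v x))\<^sup>2 = (\<Sum>j\<in>I. (s j * cmod (cinner (v j) x))\<^sup>2)"
proof -
  let ?y = "dyads I s u v *v x"
  have "cinner ?y ?y = (\<Sum>j\<in>I. cinner ?y ((of_real (s j) * cinner (v j) x) *s u j))"
    by (subst (2) dyads_mult_vec) (simp add: cinner_sum_right)
  also have "\<dots> = (\<Sum>j\<in>I. of_real ((s j * cmod (cinner (v j) x))\<^sup>2))"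
  proof (intro sum.cong refl)
    fix j assume "j \<in> I"
    then have "cinner ?y (u j) = cnj (of_real (s j) * cinner (v j) x)"
      using cinner_dyads[OF assms order_refl, of j s v x]
      by (subst cnj_cinner[symmetric]) simp
    then show "cinner ?y ((of_real (s j) * cinner (v j) x) *s u j) =
        of_real ((s j * cmod (cinner (v j) x))\<^sup>2)"
      using complex_norm_square[of "cinner (v j) x", symmetric]
      by (simp add: cinner_scale_right power_mult_distrib power2_eq_square mult_ac)
  qed
  finally have "of_real ((norm ?y)\<^sup>2) = (of_real (\<Sum>j\<in>I. (s j * cmod (cinner (v j) x))\<^sup>2) :: complex)"
    unfolding cinner_self by simp
  then show ?thesis
    by (simp only: of_real_eq_iff)
qed

lemma orthoproj_idem:
  assumes "orthonormal_on I v" "finite I"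
  shows "orthoproj I v ** orthoproj I v = orthoproj I v"
  by (simp add: dyads_mult[OF assms])

text \<open>The ranges of an orthogonal projector and of its complement are orthogonal. The two vectors may
  differ, as is needed for the difference of two projectors.\<close>

lemma norm_orthoproj_split:
  assumes "orthonormal_on I v" "finite I"
  shows "(norm (orthoproj I v *v x + (mat 1 - orthoproj I v) *v y))\<^sup>2 =
    (norm (orthoproj I v *v x))\<^sup>2 + (norm ((mat 1 - orthoproj I v) *v y))\<^sup>2"
proof -
  let ?P = "orthoproj I v"
  have "?P *v ((mat 1 - ?P) *v y) = 0"
    by (simp add: matrix_vector_mult_diff_rdistrib matrix_vector_mult_diff_distrib
        matrix_vector_mul_assoc orthoproj_idem[OF assms])
  then have "(?P *v x) \<bullet> ((mat 1 - ?P) *v y) = 0"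
    by (simp add: inner_adjoint conj_transpose_dyads)
  then show ?thesis
    by (simp add: norm_add_Pythagorean orthogonal_def)
qed

lemma norm_orthoproj_pythagoras:
  assumes "orthonormal_on I v" "finite I"
  shows "(norm x)\<^sup>2 = (norm (orthoproj I v *v x))\<^sup>2 + (norm ((mat 1 - orthoproj I v) *v x))\<^sup>2"
  using norm_orthoproj_split[OF assms, of x x] by (simp add: matrix_vector_mult_diff_rdistrib)

lemma norm_orthoproj_le:
  assumes "orthonormal_on I v" "finite I"
  shows "norm (orthoproj I v *v x) \<le> norm x" "norm ((mat 1 - orthoproj I v) *v x) \<le> norm x"
  using norm_orthoproj_pythagoras[OF assms, of x] by (auto intro: power2_le_imp_le)

lemma spectral_norm_orthoproj_le:
  assumes "orthonormal_on I v" "finite I"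
  shows "spectral_norm (orthoproj I v) \<le> 1" "spectral_norm (mat 1 - orthoproj I v) \<le> 1"
  using norm_orthoproj_le[OF assms] by (auto intro: spectral_norm_leI)

lemma norm_dyads_le:
  assumes "orthonormal_on I u" "orthonormal_on I v" "finite I" "0 \<le> b"
    and "\<And>j. j \<in> I \<Longrightarrow> \<bar>s j\<bar> \<le> b"
  shows "norm (dyads I s u v *v x) \<le> b * norm x"
proof -
  have "(s j)\<^sup>2 \<le> b\<^sup>2" if "j \<in> I" for j
    using assms(4,5) that by (simp flip: abs_le_square_iff)
  then have "(norm (dyads I s u v *v x))\<^sup>2 \<le> (\<Sum>j\<in>I. (b * cmod (cinner (v j) x))\<^sup>2)"
    unfolding norm_dyads_sq[OF assms(1,3)] power_mult_distrib
    by (intro sum_mono mult_right_mono) auto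
  also have "\<dots> = (b * norm (orthoproj I v *v x))\<^sup>2"
    unfolding power_mult_distrib norm_dyads_sq[OF assms(2,3)]
    by (simp add: sum_distrib_left)
  finally have "norm (dyads I s u v *v x) \<le> b * norm (orthoproj I v *v x)"
    using assms(4) by (auto intro: power2_le_imp_le)
  also have "\<dots> \<le> b * norm x"
    using assms by (intro mult_left_mono norm_orthoproj_le)
  finally show ?thesis .
qed

text \<open>A lower bound can hold only on the span of the \<open>v j\<close>, so it is relative to the projection of
  \<open>x\<close> onto that span.\<close>

lemma norm_dyads_ge:
  assumes "orthonormal_on I u" "orthonormal_on I v" "finite I" "0 \<le> a"
    and "\<And>j. j \<in> I \<Longrightarrow> a \<le> s j"
  shows "a * norm (orthoproj I v *v x) \<le> norm (dyads I s u v *v x)"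
proof -
  have "(a * norm (orthoproj I v *v x))\<^sup>2 = (\<Sum>j\<in>I. (a * cmod (cinner (v j) x))\<^sup>2)"
    unfolding power_mult_distrib norm_dyads_sq[OF assms(2,3)]
    by (simp add: sum_distrib_left)
  also have "\<dots> \<le> (norm (dyads I s u v *v x))\<^sup>2"
    unfolding norm_dyads_sq[OF assms(1,3)]
    by (intro sum_mono power_mono mult_right_mono) (use assms in auto)
  finally show ?thesis
    by (auto intro: power2_le_imp_le)
qed

lemma spectral_norm_dyads_le:
  assumes "orthonormal_on I u" "orthonormal_on I v" "finite I" "0 \<le> b"
    and "\<And>j. j \<in> I \<Longrightarrow> \<bar>s j\<bar> \<le> b"
  shows "spectral_norm (dyads I s u v) \<le> b"
  using norm_dyads_le[OF assms] by (rule spectral_norm_leI)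

lemma norm_orthonormal: "orthonormal_on I v \<Longrightarrow> i \<in> I \<Longrightarrow> norm (v i) = 1"
  using cinner_self[of "v i"] orthonormal_onD[of I v i i]
  by (metis norm_ge_zero of_real_1 of_real_eq_iff one_power2 power2_eq_iff_nonneg zero_le_one)

lemma dyads_mult_vec_basis:
  assumes "orthonormal_on I v" "finite I" "i \<in> I"
  shows "dyads I s u v *v v i = s i *\<^sub>R u i"
proof -
  have "dyads I s u v *v v i = (\<Sum>j\<in>I. if j = i then of_real (s i) *s u i else 0)"
    unfolding dyads_mult_vec
    by (intro sum.cong) (use assms in \<open>auto simp: orthonormal_onD\<close>)
  also have "\<dots> = s i *\<^sub>R u i"
    using assms by (simp add: vec_eq_iff scaleR_conv_of_real[where 'a=complex])
  finally show ?thesis .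
qed

lemma spectral_norm_dyads_ge:
  assumes "orthonormal_on I u" "orthonormal_on I v" "finite I" "i \<in> I"
  shows "s i \<le> spectral_norm (dyads I s u v)"
  using norm_mult_vec_le[of "dyads I s u v" "v i"] norm_orthonormal[OF assms(1,4)]
    norm_orthonormal[OF assms(2,4)]
  by (simp add: dyads_mult_vec_basis[OF assms(2,3,4)])

lemma spectral_norm_dyads:
  assumes "orthonormal_on I u" "orthonormal_on I v" "finite I" "i \<in> I"
    and "\<And>j. j \<in> I \<Longrightarrow> 0 \<le> s j \<and> s j \<le> s i"
  shows "spectral_norm (dyads I s u v) = s i"
  by (intro order_antisym spectral_norm_dyads_le spectral_norm_dyads_ge assms(1-4))
    (use assms in auto)

section \<open>Orthonormal families and their spans\<close>

lemma subspace_sol: "vec.subspace (sol A)"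
  by (simp add: sol_def vec.subspace_def matrix_vector_right_distrib vector_scalar_commute)

lemma orthoproj_mult_vec_in_span: "orthoproj I v *v x \<in> vec.span (v ` I)"
  unfolding dyads_mult_vec by (intro vec.span_sum vec.span_scale vec.span_base) auto

lemma orthoproj_mult_vec_span:
  assumes "orthonormal_on I v" "finite I" "x \<in> vec.span (v ` I)"
  shows "orthoproj I v *v x = x"
proof -
  have "v ` I \<subseteq> sol (mat 1 - orthoproj I v)"
    by (auto simp: sol_def matrix_vector_mult_diff_rdistrib dyads_mult_vec_basis[OF assms(1,2)])
  then have "x \<in> sol (mat 1 - orthoproj I v)"
    using vec.span_minimal[OF _ subspace_sol] assms(3) by blast
  then show ?thesis
    by (simp add: sol_def matrix_vector_mult_diff_rdistrib)
qed

lemma orthonormal_inj_on: "orthonormal_on I v \<Longrightarrow> inj_on v I"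
  by (rule inj_onI) (metis orthonormal_onD zero_neq_one)

text \<open>A vector of the family that lies in the span of the others is fixed by their projector, yet
  orthogonal to the range of that projector.\<close>

lemma orthonormal_independent:
  assumes "orthonormal_on I v" "finite I"
  shows "vec.independent (v ` I)"
proof
  assume "vec.dependent (v ` I)"
  then obtain i where i: "i \<in> I" "v i \<in> vec.span (v ` I - {v i})"
    by (auto simp: vec.dependent_def)
  have "v ` I - {v i} \<subseteq> v ` (I - {i})"
    by auto
  then have "v i \<in> vec.span (v ` (I - {i}))"
    using i vec.span_mono by blast
  then have "orthoproj (I - {i}) v *v v i = v i"
    using assms by (intro orthoproj_mult_vec_span orthonormal_on_subset[OF assms(1)]) auto
  then have "cinner (v i) (v i) = 0"
    using cinner_dyads[OF assms, of "I - {i}" i "\<lambda>_. 1" v "v i"] i(1) by simp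
  then show False
    using orthonormal_onD[OF assms(1) i(1) i(1)] by simp
qed

lemma dim_span_orthonormal:
  assumes "orthonormal_on I v" "finite I"
  shows "vec.dim (vec.span (v ` I)) = card I"
  unfolding vec.dim_span_eq_card_independent[OF orthonormal_independent[OF assms]]
  by (rule card_image[OF orthonormal_inj_on[OF assms(1)]])

lemma orthonormal_on_snoc:
  assumes "orthonormal_on {1..k} v" "norm w = 1" "\<And>j. j \<in> {1..k} \<Longrightarrow> cinner (v j) w = 0"
  shows "orthonormal_on {1..Suc k} (v(Suc k := w))"
proof -
  have "cinner w (v j) = 0" if "j \<in> {1..k}" for j
    using assms(3)[OF that] by (subst cnj_cinner[symmetric]) simp
  then show ?thesis
    using assms by (auto simp: orthonormal_on_def cinner_self[of w] le_Suc_eq)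
qed

lemma orthonormal_extend_one:
  fixes v :: "nat \<Rightarrow> complex^'n"
  assumes "orthonormal_on {1..k} v" "k < CARD('n)"
  obtains w where "norm w = 1" "\<And>j. j \<in> {1..k} \<Longrightarrow> cinner (v j) w = 0"
proof -
  have "vec.dim (vec.span (v ` {1..k})) \<noteq> vec.dim (UNIV :: (complex^'n) set)"
    unfolding dim_span_orthonormal[OF assms(1) finite_atLeastAtMost] vec_dim_card
    using assms(2) by simp
  then obtain x where x: "x \<notin> vec.span (v ` {1..k})"
    by (metis UNIV_eq_I)
  define y where "y = x - orthoproj {1..k} v *v x"
  have "y \<noteq> 0"
    using x orthoproj_mult_vec_in_span[of "{1..k}" v x] by (auto simp: y_def)
  have orth: "cinner (v j) y = 0" if "j \<in> {1..k}" for j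
    using that by (simp add: y_def cinner_diff_right cinner_dyads[OF assms(1)])
  show thesis
  proof
    show "norm (inverse (norm y) *\<^sub>R y) = 1"
      using \<open>y \<noteq> 0\<close> by simp
    have "inverse (norm y) *\<^sub>R y = of_real (inverse (norm y)) *s y"
      by (simp add: vec_eq_iff scaleR_conv_of_real[where 'a = complex])
    then show "cinner (v j) (inverse (norm y) *\<^sub>R y) = 0" if "j \<in> {1..k}" for j
      using orth[OF that] by (simp add: cinner_scale_right)
  qed
qed

lemma orthonormal_extend:
  fixes v :: "nat \<Rightarrow> complex^'n"
  assumes "orthonormal_on {1..k} v" "k \<le> CARD('n)"
  obtains w where "orthonormal_on {1..CARD('n)} w" "\<And>j. j \<in> {1..k} \<Longrightarrow> w j = v j"
proof -
  have "\<exists>w. orthonormal_on {1..l} w \<and> (\<forall>j\<in>{1..k}. w j = v j)" if "k \<le> l" "l \<le> CARD('n)" for l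
    using that
  proof (induction l rule: dec_induct)
    case base
    then show ?case using assms(1) by blast
  next
    case (step l)
    then obtain w where w: "orthonormal_on {1..l} w" "\<forall>j\<in>{1..k}. w j = v j"
      by auto
    obtain x where x: "norm x = 1" "\<And>j. j \<in> {1..l} \<Longrightarrow> cinner (w j) x = 0"
      using orthonormal_extend_one[OF w(1)] step by (metis Suc_le_lessD)
    show ?case
    proof (intro exI conjI)
      show "orthonormal_on {1..Suc l} (w(Suc l := x))"
        using w(1) x by (rule orthonormal_on_snoc)
      show "\<forall>j\<in>{1..k}. (w(Suc l := x)) j = v j"
        using w(2) step by auto
    qed
  qed
  then show thesis
    using that assms(2) by blast
qed

lemma span_orthonormal_full:
  fixes v :: "nat \<Rightarrow> complex^'n"
  assumes "orthonormal_on {1..CARD('n)} v"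
  shows "vec.span (v ` {1..CARD('n)}) = UNIV"
proof -
  have "vec.dim (UNIV :: (complex^'n) set) \<le> card (v ` {1..CARD('n)})"
    unfolding vec_dim_card card_image[OF orthonormal_inj_on[OF assms]] by simp
  then show ?thesis
    using vec.card_ge_dim_independent[OF subset_UNIV orthonormal_independent[OF assms]]
    by blast
qed

lemma orthoproj_full:
  fixes v :: "nat \<Rightarrow> complex^'n"
  assumes "orthonormal_on {1..CARD('n)} v"
  shows "orthoproj {1..CARD('n)} v = mat 1"
  using orthoproj_mult_vec_span[OF assms] span_orthonormal_full[OF assms]
  by (simp add: matrix_eq)

section \<open>Existence of singular value decompositions\<close>

lemma mult_vec_scaleR: "A *v (c *\<^sub>R x) = c *\<^sub>R (A *v x)"
  for A :: "complex^'n^'m"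
  by (rule linear_scale) simp

text \<open>The unit sphere is compact.\<close>

lemma spectral_norm_attained:
  obtains v where "norm v = 1" "norm (A *v v) = spectral_norm A"
proof -
  have "sphere (0 :: complex^'n) 1 \<noteq> {}"
    using vector_choose_size[of 1, where 'a = "complex^'n"] by force
  moreover have "continuous_on (sphere 0 1) (\<lambda>x. norm (A *v x))"
    by (intro continuous_intros linear_continuous_on) simp
  ultimately obtain v where v: "norm v = 1" "\<And>x. norm x = 1 \<Longrightarrow> norm (A *v x) \<le> norm (A *v v)"
    using continuous_attains_sup[of "sphere 0 1" "\<lambda>x. norm (A *v x)"] compact_sphere by auto
  have "norm (A *v x) \<le> norm (A *v v) * norm x" for x
  proof (cases "x = 0")
    case False
    then have "norm (A *v (inverse (norm x) *\<^sub>R x)) \<le> norm (A *v v)"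
      by (intro v) simp
    then show ?thesis
      using False by (simp add: mult_vec_scaleR field_simps)
  qed simp
  then have "spectral_norm A \<le> norm (A *v v)"
    by (rule spectral_norm_leI)
  then show thesis
    using that[OF v(1)] norm_mult_vec_le[of A v] v(1) by simp
qed

text \<open>With \<open>s = \<parallel>A\<parallel>\<close>, expanding the square gives
  \<open>\<parallel>A\<^sup>H A v - s\<^sup>2 v\<parallel>\<^sup>2 = \<parallel>A\<^sup>H A v\<parallel>\<^sup>2 - 2 s\<^sup>2 \<parallel>A v\<parallel>\<^sup>2 + s\<^sup>4 \<le> s\<^sup>4 - 2 s\<^sup>4 + s\<^sup>4 = 0\<close>. This replaces
  the usual variational argument.\<close>

lemma norm_maximiser_eigenvector:
  assumes "norm v = 1" "norm (A *v v) = spectral_norm A"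
  shows "conj_transpose A *v (A *v v) = (spectral_norm A)\<^sup>2 *\<^sub>R v"
proof -
  let ?s = "spectral_norm A" and ?y = "conj_transpose A *v (A *v v)"
  have "?y \<bullet> v = ?s\<^sup>2"
    by (metis assms(2) conj_transpose_conj_transpose inner_adjoint power2_norm_eq_inner)
  moreover have "norm ?y \<le> ?s * ?s"
    using norm_mult_vec_le[of "conj_transpose A" "A *v v"] assms(2)
    by (simp add: spectral_norm_conj_transpose)
  then have "(norm ?y)\<^sup>2 \<le> (?s * ?s)\<^sup>2"
    by (intro power_mono) auto
  moreover have "(norm (?y - ?s\<^sup>2 *\<^sub>R v))\<^sup>2 = (norm ?y)\<^sup>2 - 2 * ?s\<^sup>2 * (?y \<bullet> v) + (?s * ?s)\<^sup>2"
  proof -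
    have "v \<bullet> v = 1"
      using assms(1) by (simp add: norm_eq_1)
    then show ?thesis
      unfolding power2_norm_eq_inner inner_diff_left inner_diff_right
      by (simp add: inner_commute power2_eq_square algebra_simps)
  qed
  ultimately have "(norm (?y - ?s\<^sup>2 *\<^sub>R v))\<^sup>2 \<le> 0"
    by (simp add: power2_eq_square)
  then show ?thesis
    by simp
qed

text \<open>The deflation step of the construction: \<open>A\<close> stands for the remainder after \<open>k\<close> dyads have been
  split off. If it is nonzero, a norm maximiser \<open>x\<close> is orthogonal to the kernel of \<open>A\<close>
  because it lies in the range of \<open>A\<^sup>H\<close>, and \<open>A x\<close> is likewise orthogonal to the kernel of \<open>A\<^sup>H\<close>. For a zero remainder any vectors
  orthogonal to the previous ones will do, and they exist as \<open>k\<close> is below both dimensions.\<close>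

lemma exists_top_singular_pair:
  fixes A :: "complex^'n^'m"
  assumes v: "orthonormal_on {1..k} v" "k < CARD('n)" "\<And>j. j \<in> {1..k} \<Longrightarrow> A *v v j = 0"
    and u: "orthonormal_on {1..k} u" "k < CARD('m)" "\<And>j. j \<in> {1..k} \<Longrightarrow> conj_transpose A *v u j = 0"
  obtains y x where "norm y = 1" "norm x = 1"
    "A *v x = spectral_norm A *\<^sub>R y" "conj_transpose A *v y = spectral_norm A *\<^sub>R x"
    "\<And>j. j \<in> {1..k} \<Longrightarrow> cinner (u j) y = 0" "\<And>j. j \<in> {1..k} \<Longrightarrow> cinner (v j) x = 0"
proof (cases "A = 0")
  case True
  obtain y where "norm y = 1" "\<And>j. j \<in> {1..k} \<Longrightarrow> cinner (u j) y = 0"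
    using orthonormal_extend_one[OF u(1,2)] by blast
  moreover obtain x where "norm x = 1" "\<And>j. j \<in> {1..k} \<Longrightarrow> cinner (v j) x = 0"
    using orthonormal_extend_one[OF v(1,2)] by blast
  moreover have "conj_transpose A = 0" "spectral_norm A = 0"
    using True by (simp_all add: spectral_norm_eq_0 conj_transpose_def vec_eq_iff)
  ultimately show thesis
    using that[of y x] True by simp
next
  case False
  define s where "s = spectral_norm A"
  have "s > 0"
    using False spectral_norm_nonneg[of A] spectral_norm_eq_0[of A] by (simp add: s_def)
  obtain x where x: "norm x = 1" "norm (A *v x) = s"
    unfolding s_def using spectral_norm_attained .
  define y where "y = inverse s *\<^sub>R (A *v x)"
  have Ax: "A *v x = s *\<^sub>R y"
    using \<open>s > 0\<close> by (simp add: y_def)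
  have "conj_transpose A *v (s *\<^sub>R y) = s\<^sup>2 *\<^sub>R x"
    using norm_maximiser_eigenvector[of x A] x unfolding Ax[symmetric] by (simp add: s_def)
  then have Ay: "conj_transpose A *v y = s *\<^sub>R x"
    using \<open>s > 0\<close> by (simp add: mult_vec_scaleR power2_eq_square flip: scaleR_scaleR)
  have scale: "r *\<^sub>R z = of_real r *s z" for r and z :: "complex^'c"
    by (simp add: vec_eq_iff scaleR_conv_of_real[where 'a = complex])
  have "cinner (u j) y = 0" if "j \<in> {1..k}" for j
  proof -
    have "of_real s * cinner (u j) y = cinner (u j) (A *v x)"
      by (simp add: Ax scale cinner_scale_right)
    also have "\<dots> = cinner (conj_transpose A *v u j) x"
      by (simp add: cinner_adjoint)
    finally show ?thesis
      using \<open>s > 0\<close> u(3)[OF that] by simp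
  qed
  moreover have "cinner (v j) x = 0" if "j \<in> {1..k}" for j
  proof -
    have "of_real s * cinner (v j) x = cinner (v j) (conj_transpose A *v y)"
      by (simp add: Ay vec_eq_iff scaleR_conv_of_real[where 'a = complex] cinner_def sum_distrib_left mult_ac)
    also have "\<dots> = cinner (A *v v j) y"
      by (simp add: cinner_adjoint)
    finally show ?thesis
      using \<open>s > 0\<close> v(3)[OF that] by simp
  qed
  moreover have "norm y = 1"
    using x \<open>s > 0\<close> by (simp add: y_def)
  ultimately show thesis
    using that[of y x] x(1) Ax Ay by (simp add: s_def)
qed

text \<open>Each step splits off a dyad whose coefficient is the norm of the remainder. The new remainder annihilates
  all vectors found so far, and its norm never grows, which makes the \<open>\<sigma> j\<close> decrease.\<close>

lemma partial_svd:
  fixes A :: "complex^'n^'m"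
  assumes "k \<le> min CARD('m) CARD('n)"
  shows "\<exists>\<sigma> u v. orthonormal_on {1..k} u \<and> orthonormal_on {1..k} v \<and>
    (\<forall>i\<in>{1..k}. \<forall>j\<in>{1..k}. i \<le> j \<longrightarrow> \<sigma> j \<le> \<sigma> i) \<and>
    (\<forall>j\<in>{1..k}. (A - dyads {1..k} \<sigma> u v) *v v j = 0 \<and>
       conj_transpose (A - dyads {1..k} \<sigma> u v) *v u j = 0 \<and>
       spectral_norm (A - dyads {1..k} \<sigma> u v) \<le> \<sigma> j)"
  using assms
proof (induction k)
  case 0
  then show ?case by (simp add: orthonormal_on_def)
next
  case (Suc k)
  then have "k \<le> min CARD('m) CARD('n)"
    by simp
  from Suc.IH[OF this] obtain \<sigma> u v where ih: "orthonormal_on {1..k} u" "orthonormal_on {1..k} v"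
    "\<forall>i\<in>{1..k}. \<forall>j\<in>{1..k}. i \<le> j \<longrightarrow> \<sigma> j \<le> \<sigma> i"
    and kill: "\<forall>j\<in>{1..k}. (A - dyads {1..k} \<sigma> u v) *v v j = 0 \<and>
       conj_transpose (A - dyads {1..k} \<sigma> u v) *v u j = 0 \<and>
       spectral_norm (A - dyads {1..k} \<sigma> u v) \<le> \<sigma> j"
    by (elim exE conjE) (rule that)
  define R where "R = A - dyads {1..k} \<sigma> u v"
  have R: "R *v v j = 0" "conj_transpose R *v u j = 0" "spectral_norm R \<le> \<sigma> j" if "j \<in> {1..k}" for j
    using kill that unfolding R_def by blast+
  have k: "k < CARD('n)" "k < CARD('m)"
    using Suc.prems by auto
  define s where "s = spectral_norm R"
  obtain y x where norms: "norm y = 1" "norm x = 1"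
    and Rx: "R *v x = s *\<^sub>R y" and Ry: "conj_transpose R *v y = s *\<^sub>R x"
    and orth: "\<And>j. j \<in> {1..k} \<Longrightarrow> cinner (u j) y = 0" "\<And>j. j \<in> {1..k} \<Longrightarrow> cinner (v j) x = 0"
    unfolding s_def
    using exists_top_singular_pair[OF ih(2) k(1) R(1) ih(1) k(2) R(2)] by metis
  define \<sigma>' u' v' where "\<sigma>' = \<sigma>(Suc k := s)" and "u' = u(Suc k := y)" and "v' = v(Suc k := x)"
  have u': "orthonormal_on {1..Suc k} u'" and v': "orthonormal_on {1..Suc k} v'"
    unfolding u'_def v'_def using orthonormal_on_snoc ih norms orth by blast+
  have split: "dyads {1..Suc k} \<sigma>' u' v' = dyads {1..k} \<sigma> u v + dyads {Suc k} \<sigma>' u' v'"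
    by (simp add: dyads_def \<sigma>'_def u'_def v'_def)
  define R' where "R' = A - dyads {1..Suc k} \<sigma>' u' v'"
  have R': "R' = R - dyads {Suc k} \<sigma>' u' v'"
    unfolding R'_def R_def split by simp
  have kills: "R' *v v' j = 0" "conj_transpose R' *v u' j = 0" if "j \<in> {1..Suc k}" for j
  proof -
    have "cinner x (v' j) = (if j = Suc k then 1 else 0)"
      "cinner y (u' j) = (if j = Suc k then 1 else 0)"
      using orthonormal_onD[OF v', of "Suc k" j] orthonormal_onD[OF u', of "Suc k" j] that
      by (auto simp: u'_def v'_def)
    moreover have "R *v v' j = (if j = Suc k then s *\<^sub>R y else 0)"
      "conj_transpose R *v u' j = (if j = Suc k then s *\<^sub>R x else 0)"
      using R that Rx Ry by (auto simp: u'_def v'_def)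
    ultimately show "R' *v v' j = 0" "conj_transpose R' *v u' j = 0"
      by (auto simp: R' conj_transpose_diff conj_transpose_dyads matrix_vector_mult_diff_rdistrib
          dyads_mult_vec u'_def v'_def \<sigma>'_def vec_eq_iff scaleR_conv_of_real[where 'a = complex])
  qed
  have "R ** orthoproj {Suc k} v' = dyads {Suc k} \<sigma>' u' v'"
    by (simp add: matrix_eq dyads_mult_vec v'_def u'_def \<sigma>'_def vector_scalar_commute Rx
        vec_eq_iff scaleR_conv_of_real[where 'a = complex] flip: matrix_vector_mul_assoc)
  then have "R' = R ** (mat 1 - orthoproj {Suc k} v')"
    by (simp add: R' matrix_eq matrix_vector_mult_diff_rdistrib matrix_vector_mult_diff_distrib
        flip: matrix_vector_mul_assoc)
  moreover have "spectral_norm (mat 1 - orthoproj {Suc k} v') \<le> 1"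
    by (rule spectral_norm_orthoproj_le) (use orthonormal_on_subset[OF v', of "{Suc k}"] in auto)
  ultimately have le: "spectral_norm R' \<le> s"
    using spectral_norm_mult[of R] spectral_norm_nonneg[of R] mult_left_mono
    unfolding s_def by (metis dual_order.trans mult.right_neutral)
  have "\<sigma>' j \<le> \<sigma>' i" if "i \<in> {1..Suc k}" "j \<in> {1..Suc k}" "i \<le> j" for i j
    using that ih(3) R(3) by (auto simp: \<sigma>'_def s_def le_Suc_eq)
  moreover have "spectral_norm R' \<le> \<sigma>' j" if "j \<in> {1..Suc k}" for j
    using that R(3)[of j] le by (auto simp: \<sigma>'_def s_def le_Suc_eq)
  ultimately show ?case
    using u' v' kills unfolding R'_def by blast
qed

lemma eq_0_if_kills_orthonormal_basis:
  fixes A :: "complex^'n^'m"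
  assumes "orthonormal_on {1..CARD('n)} v" "\<And>j. j \<in> {1..CARD('n)} \<Longrightarrow> A *v v j = 0"
  shows "A = 0"
proof -
  have "vec.span (v ` {1..CARD('n)}) \<subseteq> sol A"
    by (rule vec.span_minimal[OF _ subspace_sol]) (use assms(2) in \<open>auto simp: sol_def\<close>)
  then show ?thesis
    unfolding span_orthonormal_full[OF assms(1)] by (auto simp: sol_def matrix_eq)
qed

text \<open>After \<open>min m n\<close> steps the remainder, or its adjoint, annihilates an orthonormal basis of
  the whole space.\<close>

lemma exists_svd: "\<exists>\<sigma> u v. is_svd A \<sigma> u v"
  for A :: "complex^'n^'m"
proof -
  let ?d = "min CARD('m) CARD('n)"
  obtain \<sigma> u v where uv: "orthonormal_on {1..?d} u" "orthonormal_on {1..?d} v"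
    and mono: "\<forall>i\<in>{1..?d}. \<forall>j\<in>{1..?d}. i \<le> j \<longrightarrow> \<sigma> j \<le> \<sigma> i"
    and R: "\<forall>j\<in>{1..?d}. (A - dyads {1..?d} \<sigma> u v) *v v j = 0 \<and>
       conj_transpose (A - dyads {1..?d} \<sigma> u v) *v u j = 0 \<and>
       spectral_norm (A - dyads {1..?d} \<sigma> u v) \<le> \<sigma> j"
    using partial_svd[of ?d A] by auto
  have "A - dyads {1..?d} \<sigma> u v = 0"
  proof (cases "CARD('n) \<le> CARD('m)")
    case True
    then have "?d = CARD('n)"
      by simp
    then show ?thesis
      using uv R eq_0_if_kills_orthonormal_basis[of v] by metis
  next
    case False
    then have "?d = CARD('m)"
      by simp
    then have "conj_transpose (A - dyads {1..?d} \<sigma> u v) = 0"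
      using uv R eq_0_if_kills_orthonormal_basis[of u] by metis
    then show ?thesis
      by (simp add: conj_transpose_def vec_eq_iff)
  qed
  moreover have "0 \<le> \<sigma> j" if "j \<in> {1..?d}" for j
    using R that spectral_norm_nonneg order_trans by blast
  ultimately have "is_svd A \<sigma> u v"
    using uv mono by (simp add: is_svd_def sv_index_def dyads_def)
  then show ?thesis
    by blast
qed

section \<open>Weyl's inequality and uniqueness of singular values\<close>

lemma is_svdD:
  assumes "is_svd A \<sigma> u v"
  shows "A = dyads (sv_index A) \<sigma> u v" "orthonormal_on (sv_index A) u"
    "orthonormal_on (sv_index A) v"
    "\<And>j. j \<in> sv_index A \<Longrightarrow> 0 \<le> \<sigma> j"
    "\<And>i j. \<lbrakk>i \<in> sv_index A; j \<in> sv_index A; i \<le> j\<rbrakk> \<Longrightarrow> \<sigma> j \<le> \<sigma> i"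
  using assms by (auto simp: is_svd_def dyads_def)

lemma finite_sv_index [simp]: "finite (sv_index A)"
  by (simp add: sv_index_def)

lemma svd_mult_orthoproj:
  assumes A: "is_svd A \<sigma> u v" and I: "I \<subseteq> sv_index A"
  shows "A ** orthoproj I v = dyads I \<sigma> u v"
proof -
  have "A ** orthoproj I v = dyads (sv_index A) \<sigma> u v ** orthoproj I v"
    by (rule arg_cong2[OF is_svdD(1)[OF A] refl])
  then show ?thesis
    using I by (simp add: dyads_mult[OF is_svdD(3)[OF A]] Int_absorb1)
qed

text \<open>Otherwise the projector would be injective on a space of larger dimension than its range.\<close>

lemma exists_in_span_vanishing:
  fixes v q :: "nat \<Rightarrow> complex^'n"
  assumes "orthonormal_on I v" "finite I" "finite K" "card K < card I"
  obtains x where "x \<noteq> 0" "x \<in> vec.span (v ` I)" "orthoproj K q *v x = 0"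
proof -
  let ?Q = "orthoproj K q"
  have "\<not> inj_on ((*v) ?Q) (vec.span (v ` I))"
  proof
    assume inj: "inj_on ((*v) ?Q) (vec.span (v ` I))"
    then have "vec.independent ((*v) ?Q ` v ` I)"
      by (rule vec.linear_independent_injective_image
          [OF matrix_vector_mul_linear_gen orthonormal_independent[OF assms(1,2)]])
    moreover have "(*v) ?Q ` v ` I \<subseteq> vec.span (q ` K)"
      using orthoproj_mult_vec_in_span by blast
    ultimately have "card ((*v) ?Q ` v ` I) \<le> card (q ` K)"
      using vec.independent_span_bound[of "q ` K"] assms(3) by blast
    moreover have "card ((*v) ?Q ` v ` I) = card I"
      using inj_on_subset[OF inj vec.span_superset] orthonormal_inj_on[OF assms(1)]
      by (simp add: card_image)
    ultimately show False
      using card_image_le[OF assms(3), of q] assms(4) by simp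
  qed
  then obtain x y where "x \<in> vec.span (v ` I)" "y \<in> vec.span (v ` I)" "x \<noteq> y" "?Q *v x = ?Q *v y"
    by (auto simp: inj_on_def)
  then show thesis
    using that[of "x - y"] vec.span_diff by (auto simp: matrix_vector_mult_diff_distrib)
qed

text \<open>The first \<open>j\<close> right singular vectors of \<open>A\<close> span a space of dimension \<open>j\<close>, which contains some
  \<open>x \<noteq> 0\<close> orthogonal to the first \<open>j - 1\<close> right singular vectors of \<open>B\<close>. On this vector
  \<open>\<sigma> j \<parallel>x\<parallel> \<le> \<parallel>A x\<parallel>\<close> and \<open>\<parallel>B x\<parallel> \<le> \<tau> j \<parallel>x\<parallel>\<close>.\<close>

lemma weyl_inequality:
  fixes A B :: "complex^'n^'m"
  assumes A: "is_svd A \<sigma> u v" and B: "is_svd B \<tau> p q" and j: "j \<in> sv_index A"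
  shows "\<sigma> j \<le> \<tau> j + spectral_norm (A - B)"
proof -
  define D where "D = sv_index A"
  have D: "finite D" "sv_index A = D" "sv_index B = D" "D = {1..min CARD('m) CARD('n)}"
    by (simp_all add: D_def sv_index_def)
  note A = is_svdD[OF A, unfolded D(2)] and B = is_svdD[OF B, unfolded D(3)]
  let ?I = "{1..j}" and ?K = "{1..<j}"
  have IK: "?I \<subseteq> D" "?K \<subseteq> D" "j \<in> D"
    using j D by auto
  note sub = orthonormal_on_subset
  obtain x where x: "x \<noteq> 0" "x \<in> vec.span (v ` ?I)" "orthoproj ?K q *v x = 0"
    by (rule exists_in_span_vanishing[OF sub[OF A(3) IK(1)], of ?K q]) (use IK D in auto)
  have Px: "orthoproj ?I v *v x = x"
    using x(2) by (intro orthoproj_mult_vec_span sub[OF A(3) IK(1)]) auto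
  have "A ** orthoproj ?I v = dyads ?I \<sigma> u v"
    by (subst A(1), subst dyads_mult[OF A(3) D(1)]) (use IK in \<open>auto simp: Int_absorb1\<close>)
  then have Ax: "A *v x = dyads ?I \<sigma> u v *v x"
    by (metis Px matrix_vector_mul_assoc)
  have "\<sigma> j * norm x \<le> norm (A *v x)"
    using norm_dyads_ge[OF sub[OF A(2) IK(1)] sub[OF A(3) IK(1)], of "\<sigma> j" \<sigma> x] A(4,5) IK
    by (auto simp: Px Ax subset_iff)
  moreover have "norm (B *v x) \<le> \<tau> j * norm x"
  proof -
    have "B ** orthoproj ?K q = dyads ?K \<tau> p q"
      by (subst B(1), subst dyads_mult[OF B(3) D(1)]) (use IK in \<open>auto simp: Int_absorb1\<close>)
    then have "dyads ?K \<tau> p q *v x = 0"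
      by (metis x(3) matrix_vector_mul_assoc matrix_vector_mult_0_right)
    then have "B *v x = dyads (D - ?K) \<tau> p q *v x"
      by (subst B(1)) (simp add: matrix_vector_mult_diff_rdistrib flip: dyads_diff[OF D(1) IK(2)])
    moreover have "norm (dyads (D - ?K) \<tau> p q *v x) \<le> \<tau> j * norm x"
      by (rule norm_dyads_le) (use B IK D sub[of D _ "D - ?K"] in auto)
    ultimately show ?thesis
      by simp
  qed
  moreover have "norm (A *v x) \<le> norm (B *v x) + spectral_norm (A - B) * norm x"
    using norm_triangle_sub[of "A *v x" "B *v x"] norm_mult_vec_le[of "A - B" x]
    by (simp add: matrix_vector_mult_diff_rdistrib)
  ultimately have "\<sigma> j * norm x \<le> (\<tau> j + spectral_norm (A - B)) * norm x"
    by (simp add: algebra_simps)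
  then show ?thesis
    using x(1) by simp
qed

text \<open>Weyl's inequality for two decompositions of one matrix shows that the singular values agree.\<close>

lemma singular_value_eq:
  assumes "is_svd A \<sigma> u v" "j \<in> sv_index A"
  shows "singular_value A j = \<sigma> j"
  unfolding singular_value_def
proof (rule the_equality)
  show "\<exists>\<sigma>' u v. is_svd A \<sigma>' u v \<and> \<sigma> j = \<sigma>' j"
    using assms(1) by blast
next
  fix s assume "\<exists>\<sigma> u v. is_svd A \<sigma> u v \<and> s = \<sigma> j"
  then obtain \<tau> p q where "is_svd A \<tau> p q" "s = \<tau> j"
    by blast
  moreover have "spectral_norm (A - A) = 0"
    by (simp add: spectral_norm_eq_0)
  ultimately show "s = \<sigma> j"
    using weyl_inequality[OF assms(1), of A \<tau> p q j] weyl_inequality[of A \<tau> p q A \<sigma> u v j] assms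
    by simp
qed

section \<open>The gap theorem of Wedin\<close>

text \<open>Let \<open>P, P'\<close> project onto the right and left singular vectors of \<open>A\<close> with indices in \<open>I\<close>, and let
  \<open>Q, Q'\<close> be the complementary projectors for \<open>B\<close> and \<open>J\<close>. As \<open>A P = P' A\<close> and \<open>B Q = Q' B\<close>,
  \<open>A P Q = P' Q' B Q + P' (A - B) Q\<close>. Here \<open>A\<close> stretches the range of \<open>P\<close> by at least \<open>a\<close> and \<open>B\<close>
  stretches the range of \<open>Q\<close> by at most \<open>b\<close>.\<close>

lemma wedin_step:
  assumes "orthonormal_on D u" "orthonormal_on D v" "orthonormal_on D p" "orthonormal_on D q"
    and D: "finite D" "I \<subseteq> D" "J \<subseteq> D"
    and a: "0 \<le> a" "\<And>j. j \<in> I \<Longrightarrow> a \<le> \<sigma> j"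
    and b: "0 \<le> b" "\<And>j. j \<in> D - J \<Longrightarrow> \<bar>\<tau> j\<bar> \<le> b"
  shows "a * spectral_norm (orthoproj I v ** (mat 1 - orthoproj J q)) \<le>
    b * spectral_norm (orthoproj I u ** (mat 1 - orthoproj J p)) +
    spectral_norm (dyads D \<sigma> u v - dyads D \<tau> p q)"
proof -
  define A B where "A = dyads D \<sigma> u v" and "B = dyads D \<tau> p q"
  define P P' Q Q' where "P = orthoproj I v" and "P' = orthoproj I u"
    and "Q = mat 1 - orthoproj J q" and "Q' = mat 1 - orthoproj J p"
  note sub = orthonormal_on_subset
  have fin: "finite I" "finite J"
    using D finite_subset by auto
  have AP: "A ** P = dyads I \<sigma> u v" "P' ** A = dyads I \<sigma> u v"
    unfolding A_def P_def P'_def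
    by (simp_all add: dyads_mult[OF assms(1) D(1)] dyads_mult[OF assms(2) D(1)] D
        Int_absorb1 Int_absorb2)
  have BQ: "B ** Q = dyads (D - J) \<tau> p q" "Q' ** B = dyads (D - J) \<tau> p q"
    unfolding B_def Q_def Q'_def
    by (simp_all add: matrix_sub_ldistrib matrix_sub_rdistrib dyads_mult[OF assms(3) D(1)]
        dyads_mult[OF assms(4) D(1)] D Int_absorb1 Int_absorb2 dyads_diff)
  have "orthoproj J q ** orthoproj J q = orthoproj J q"
    using assms(4) D fin sub by (intro orthoproj_idem) auto
  then have QQ: "Q ** Q = Q"
    by (simp add: Q_def matrix_sub_ldistrib matrix_sub_rdistrib)
  have "norm (B ** Q *v x) \<le> b * norm x" for x
    unfolding BQ by (rule norm_dyads_le) (use assms sub[of D _ "D - J"] in auto)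
  then have nBQ: "spectral_norm (B ** Q) \<le> b"
    by (rule spectral_norm_leI)
  have "a * norm (P ** Q *v x) \<le> spectral_norm (A ** P ** Q) * norm x" for x
  proof -
    have "a * norm (P ** Q *v x) \<le> norm (A ** P ** Q *v x)"
      unfolding AP(1) matrix_vector_mul_assoc[symmetric] unfolding P_def
      by (rule norm_dyads_ge) (use assms sub[of D _ I] fin in auto)
    then show ?thesis
      by (rule order_trans[OF _ norm_mult_vec_le])
  qed
  then have "a * spectral_norm (P ** Q) \<le> spectral_norm (A ** P ** Q)"
  proof -
    assume *: "\<And>x. a * norm (P ** Q *v x) \<le> spectral_norm (A ** P ** Q) * norm x"
    obtain x where "norm x = 1" "norm (P ** Q *v x) = spectral_norm (P ** Q)"
      by (rule spectral_norm_attained)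
    then show ?thesis
      using *[of x] by simp
  qed
  also have "A ** P ** Q = P' ** Q' ** (B ** Q) + P' ** (A - B) ** Q"
  proof -
    have "P' ** Q' ** (B ** Q) = P' ** (Q' ** B) ** Q"
      by (simp add: matrix_mul_assoc)
    also have "\<dots> = P' ** B ** (Q ** Q)"
      unfolding BQ(2) BQ(1)[symmetric] by (simp add: matrix_mul_assoc)
    also have "\<dots> = P' ** B ** Q"
      by (simp add: QQ)
    finally show ?thesis
      by (simp add: AP(1) AP(2)[symmetric] matrix_sub_ldistrib matrix_sub_rdistrib)
  qed
  also have "spectral_norm \<dots> \<le> spectral_norm (P' ** Q' ** (B ** Q)) + spectral_norm (P' ** (A - B) ** Q)"
    by (rule spectral_norm_triangle)
  also have "\<dots> \<le> spectral_norm (P' ** Q') * b + 1 * spectral_norm (A - B) * 1"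
  proof (rule add_mono)
    show "spectral_norm (P' ** Q' ** (B ** Q)) \<le> spectral_norm (P' ** Q') * b"
      by (rule order_trans[OF spectral_norm_mult mult_left_mono[OF nBQ spectral_norm_nonneg]])
    have "spectral_norm P' \<le> 1" "spectral_norm Q \<le> 1"
      unfolding P'_def Q_def using assms(1,4) D fin sub
      by (auto intro!: spectral_norm_orthoproj_le)
    then have "spectral_norm P' * spectral_norm (A - B) * spectral_norm Q
        \<le> 1 * spectral_norm (A - B) * 1"
      by (intro mult_mono) (auto simp: spectral_norm_nonneg)
    moreover have "spectral_norm (P' ** (A - B) ** Q)
        \<le> spectral_norm P' * spectral_norm (A - B) * spectral_norm Q"
      using spectral_norm_mult[of "P' ** (A - B)" Q]
        mult_right_mono[OF spectral_norm_mult[of P' "A - B"] spectral_norm_nonneg[of Q]]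
      by (rule order_trans)
    ultimately show "spectral_norm (P' ** (A - B) ** Q) \<le> 1 * spectral_norm (A - B) * 1"
      by simp
  qed
  finally show ?thesis
    by (simp add: P_def P'_def Q_def Q'_def A_def B_def mult.commute)
qed

text \<open>The preceding lemma bounds \<open>\<parallel>P Q\<parallel>\<close> in terms of \<open>\<parallel>P' Q'\<parallel>\<close> and, applied to the adjoints,
  \<open>\<parallel>P' Q'\<parallel>\<close> in terms of \<open>\<parallel>P Q\<parallel>\<close>. The larger of the two norms, \<open>z\<close>, thus satisfies
  \<open>a z \<le> b z + \<parallel>A - B\<parallel>\<close>.\<close>

lemma wedin:
  assumes "orthonormal_on D u" "orthonormal_on D v" "orthonormal_on D p" "orthonormal_on D q"
    and D: "finite D" "I \<subseteq> D" "J \<subseteq> D"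
    and "\<And>j. j \<in> I \<Longrightarrow> a \<le> \<sigma> j" "\<And>j. j \<in> D - J \<Longrightarrow> \<bar>\<tau> j\<bar> \<le> b"
    and "0 \<le> b" "0 < g" "b + g \<le> a"
  shows "g * spectral_norm (orthoproj I v ** (mat 1 - orthoproj J q)) \<le>
    spectral_norm (dyads D \<sigma> u v - dyads D \<tau> p q)"
proof -
  define x y e where "x = spectral_norm (orthoproj I v ** (mat 1 - orthoproj J q))"
    and "y = spectral_norm (orthoproj I u ** (mat 1 - orthoproj J p))"
    and "e = spectral_norm (dyads D \<sigma> u v - dyads D \<tau> p q)"
  have "0 \<le> a"
    using assms by linarith
  have "spectral_norm (dyads D \<sigma> v u - dyads D \<tau> q p) = e"
    unfolding e_def
    by (subst spectral_norm_conj_transpose[symmetric]) (simp add: conj_transpose_diff conj_transpose_dyads)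
  moreover have "a * y \<le> b * x + spectral_norm (dyads D \<sigma> v u - dyads D \<tau> q p)"
    unfolding x_def y_def by (rule wedin_step) (use assms \<open>0 \<le> a\<close> in auto)
  moreover have "a * x \<le> b * y + e"
    unfolding x_def y_def e_def by (rule wedin_step) (use assms \<open>0 \<le> a\<close> in auto)
  ultimately have step: "a * x \<le> b * y + e" "a * y \<le> b * x + e"
    by simp_all
  have "x \<ge> 0"
    by (simp add: x_def spectral_norm_nonneg)
  have "(b + g) * max x y \<le> a * max x y"
    using assms \<open>x \<ge> 0\<close> by (intro mult_right_mono) auto
  also have "a * max x y \<le> b * max x y + e"
    using step mult_left_mono[OF max.cobounded1[of x y] assms(10)]
      mult_left_mono[OF max.cobounded2[of y x] assms(10)] by (auto simp: max_def)
  finally have "g * max x y \<le> e"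
    by (simp add: algebra_simps)
  moreover have "g * x \<le> g * max x y"
    using assms by simp
  ultimately show ?thesis
    by (simp add: x_def e_def)
qed

text \<open>Write \<open>(P - P') x = P (1 - P') x - (1 - P) P' x\<close>. The two terms are orthogonal, and their norms
  are at most \<open>c \<parallel>(1 - P') x\<parallel>\<close> and \<open>c \<parallel>P' x\<parallel>\<close>, whose squares add up to
  \<open>c\<^sup>2 \<parallel>x\<parallel>\<^sup>2\<close>. Using both bounds avoids the fact that they are equivalent for projectors of equal
  rank.\<close>

lemma spectral_norm_orthoproj_diff_le:
  assumes v: "orthonormal_on I v" "finite I" and w: "orthonormal_on J w" "finite J"
    and c: "spectral_norm (orthoproj I v ** (mat 1 - orthoproj J w)) \<le> c"
      "spectral_norm (orthoproj J w ** (mat 1 - orthoproj I v)) \<le> c"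
  shows "spectral_norm (orthoproj I v - orthoproj J w) \<le> c"
proof (rule spectral_norm_leI)
  fix x
  define P P' where "P = orthoproj I v" and "P' = orthoproj J w"
  have "0 \<le> c"
    using c(1) spectral_norm_nonneg order_trans by blast
  have "conj_transpose (P' ** (mat 1 - P)) = (mat 1 - P) ** P'"
    by (simp add: P_def P'_def conj_transpose_mult conj_transpose_diff conj_transpose_dyads)
  then have c2: "spectral_norm ((mat 1 - P) ** P') \<le> c"
    using c(2) spectral_norm_conj_transpose by (metis P_def P'_def)
  have idem: "P' ** P' = P'" "P ** P = P"
    using v w by (simp_all add: P_def P'_def orthoproj_idem)
  have 1: "norm (P *v ((mat 1 - P') *v x)) \<le> c * norm ((mat 1 - P') *v x)"
  proof -
    have "P *v ((mat 1 - P') *v x) = (P ** (mat 1 - P')) *v ((mat 1 - P') *v x)"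
      by (simp add: matrix_vector_mul_assoc matrix_sub_ldistrib matrix_sub_rdistrib
          idem flip: matrix_mul_assoc)
    also have "norm \<dots> \<le> spectral_norm (P ** (mat 1 - P')) * norm ((mat 1 - P') *v x)"
      by (rule norm_mult_vec_le)
    also have "\<dots> \<le> c * norm ((mat 1 - P') *v x)"
      using c(1) by (intro mult_right_mono) (simp_all add: P_def P'_def)
    finally show ?thesis .
  qed
  have 2: "norm ((mat 1 - P) *v (P' *v x)) \<le> c * norm (P' *v x)"
  proof -
    have "(mat 1 - P) *v (P' *v x) = ((mat 1 - P) ** P') *v (P' *v x)"
      by (simp add: matrix_vector_mul_assoc idem flip: matrix_mul_assoc)
    also have "norm \<dots> \<le> spectral_norm ((mat 1 - P) ** P') * norm (P' *v x)"
      by (rule norm_mult_vec_le)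
    also have "\<dots> \<le> c * norm (P' *v x)"
      using c2 by (rule mult_right_mono) simp
    finally show ?thesis .
  qed
  have "(P - P') *v x = P *v ((mat 1 - P') *v x) + (mat 1 - P) *v (- (P' *v x))"
    by (simp add: matrix_vector_mult_diff_rdistrib matrix_vector_mult_diff_distrib vec.neg)
  then have "(norm ((P - P') *v x))\<^sup>2 =
      (norm (P *v ((mat 1 - P') *v x)))\<^sup>2 + (norm ((mat 1 - P) *v (P' *v x)))\<^sup>2"
    using norm_orthoproj_split[OF v, of "(mat 1 - P') *v x" "- (P' *v x)"]
    by (simp add: P_def vec.neg)
  also have "\<dots> \<le> (c * norm ((mat 1 - P') *v x))\<^sup>2 + (c * norm (P' *v x))\<^sup>2"
    by (intro add_mono power_mono 1 2) auto
  also have "\<dots> = c\<^sup>2 * ((norm (P' *v x))\<^sup>2 + (norm ((mat 1 - P') *v x))\<^sup>2)"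
    by (simp add: power_mult_distrib algebra_simps)
  also have "\<dots> = (c * norm x)\<^sup>2"
    using norm_orthoproj_pythagoras[OF w, of x] by (simp add: P'_def power_mult_distrib)
  finally have "norm ((P - P') *v x) \<le> c * norm x"
    using \<open>0 \<le> c\<close> by (auto intro: power2_le_imp_le)
  then show "norm ((orthoproj I v - orthoproj J w) *v x) \<le> c * norm x"
    by (simp add: P_def P'_def)
qed

text \<open>The gap condition is imposed crosswise between the large singular values of one matrix and the
  small ones of the other, which is how Wedin's theorem uses it.\<close>

lemma orthoproj_perturbation:
  fixes A B :: "complex^'n^'m"
  assumes A: "is_svd A \<sigma> u v" and B: "is_svd B \<tau> p q" and r: "{1..r} \<subseteq> sv_index A"
    and \<sigma>: "\<And>j. j \<in> {1..r} \<Longrightarrow> a \<le> \<sigma> j" "\<And>j. j \<in> sv_index A - {1..r} \<Longrightarrow> \<sigma> j \<le> b"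
    and \<tau>: "\<And>j. j \<in> {1..r} \<Longrightarrow> a' \<le> \<tau> j" "\<And>j. j \<in> sv_index A - {1..r} \<Longrightarrow> \<tau> j \<le> b'"
    and "0 \<le> b" "0 \<le> b'" and g: "0 < g" "b' + g \<le> a" "b + g \<le> a'"
  shows "spectral_norm (orthoproj {1..r} v - orthoproj {1..r} q) \<le> spectral_norm (A - B) / g"
proof (rule spectral_norm_orthoproj_diff_le)
  have D: "sv_index B = sv_index A"
    by (simp add: sv_index_def)
  note A = is_svdD[OF A] and B = is_svdD[OF B, unfolded D]
  show "orthonormal_on {1..r} v" "orthonormal_on {1..r} q"
    using A(3) B(3) r orthonormal_on_subset by blast+
  have abs: "\<bar>\<sigma> j\<bar> \<le> b" "\<bar>\<tau> j\<bar> \<le> b'" if "j \<in> sv_index A - {1..r}" for j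
    using \<sigma>(2)[OF that] \<tau>(2)[OF that] A(4) B(4) that by auto
  have diff: "A - B = dyads (sv_index A) \<sigma> u v - dyads (sv_index A) \<tau> p q"
    "B - A = dyads (sv_index A) \<tau> p q - dyads (sv_index A) \<sigma> u v"
    by (rule arg_cong2[OF A(1) B(1)], rule arg_cong2[OF B(1) A(1)])
  have "g * spectral_norm (orthoproj {1..r} v ** (mat 1 - orthoproj {1..r} q)) \<le>
      spectral_norm (A - B)"
    by (unfold diff, rule wedin)
      (use A(2,3) B(2,3) r \<sigma>(1) abs(2) \<open>0 \<le> b'\<close> g in auto)
  then show "spectral_norm (orthoproj {1..r} v ** (mat 1 - orthoproj {1..r} q)) \<le>
      spectral_norm (A - B) / g"
    using g by (simp add: field_simps)
  have "g * spectral_norm (orthoproj {1..r} q ** (mat 1 - orthoproj {1..r} v)) \<le>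
      spectral_norm (B - A)"
    by (unfold diff, rule wedin[where a = a' and b = b])
      (use A(2,3) B(2,3) r \<tau>(1) abs(1) \<open>0 \<le> b\<close> g in auto)
  then show "spectral_norm (orthoproj {1..r} q ** (mat 1 - orthoproj {1..r} v)) \<le>
      spectral_norm (A - B) / g"
    using g by (simp add: field_simps spectral_norm_minus_commute[of A B])
qed auto

section \<open>The Moore-Penrose inverse and the rank\<close>

lemma is_pinv_unique:
  assumes X: "is_pinv A X" and Y: "is_pinv A Y"
  shows "X = Y"
proof -
  have "A ** X = conj_transpose (A ** Y ** A ** X)"
    using X Y by (simp add: is_pinv_def)
  also have "\<dots> = conj_transpose (A ** X) ** conj_transpose (A ** Y)"
    by (simp add: matrix_mul_assoc flip: conj_transpose_mult)
  also have "\<dots> = A ** Y"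
    using X Y by (simp add: is_pinv_def matrix_mul_assoc)
  finally have AX: "A ** X = A ** Y" .
  have "X ** A = conj_transpose (X ** (A ** Y ** A))"
    using X Y by (simp add: is_pinv_def)
  also have "\<dots> = conj_transpose (Y ** A) ** conj_transpose (X ** A)"
    by (simp add: matrix_mul_assoc flip: conj_transpose_mult)
  also have "\<dots> = (Y ** A) ** (X ** A)"
    using X Y by (simp add: is_pinv_def)
  also have "\<dots> = Y ** (A ** X ** A)"
    by (simp only: matrix_mul_assoc)
  also have "\<dots> = Y ** A"
    using X by (simp add: is_pinv_def)
  finally have XA: "X ** A = Y ** A" .
  have "X = X ** A ** X" "Y = Y ** A ** Y"
    using X Y by (simp_all add: is_pinv_def)
  then show ?thesis
    using AX XA by (metis matrix_mul_assoc)
qed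

lemma pinv_dyads:
  assumes "orthonormal_on I u" "orthonormal_on I v" "finite I" "\<And>j. j \<in> I \<Longrightarrow> s j \<noteq> 0"
  shows "pinv (dyads I s u v) = dyads I (\<lambda>j. inverse (s j)) v u"
proof -
  let ?A = "dyads I s u v" and ?X = "dyads I (\<lambda>j. inverse (s j)) v u"
  have AX: "?A ** ?X = orthoproj I u" and XA: "?X ** ?A = orthoproj I v"
    using assms(4) by (auto simp: dyads_mult[OF assms(1,3)] dyads_mult[OF assms(2,3)]
        intro!: dyads_cong)
  have "is_pinv ?A ?X"
    unfolding is_pinv_def AX XA
    by (auto simp: dyads_mult[OF assms(1,3)] dyads_mult[OF assms(2,3)] conj_transpose_dyads)
  then show ?thesis
    unfolding pinv_def using is_pinv_unique by blast
qed

text \<open>The rank is defined by rows, and the rows of the matrix span the same space as the entrywise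
  conjugates of the \<open>v j\<close>, which are again orthonormal.\<close>

lemma rank_dyads:
  fixes u :: "nat \<Rightarrow> complex^'m" and v :: "nat \<Rightarrow> complex^'n"
  assumes "orthonormal_on I u" "orthonormal_on I v" "finite I" "\<And>j. j \<in> I \<Longrightarrow> s j \<noteq> 0"
  shows "rank (dyads I s u v) = card I"
proof -
  let ?A = "dyads I s u v"
  define c where "c j = (\<chi> k. cnj (v j $ k))" for j
  have "cinner (c i) (c j) = cinner (v j) (v i)" for i j
    by (simp add: cinner_def c_def mult.commute)
  then have c: "orthonormal_on I c"
    using assms(2) by (auto simp: orthonormal_on_def)
  have entry: "?A $ i $ k = (\<Sum>j\<in>I. of_real (s j) * u j $ i * c j $ k)" for i k
    by (simp add: dyads_def outer_def c_def scaleR_conv_of_real[where 'a = complex] mult.assoc)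
  have "row i ?A = (\<Sum>j\<in>I. (of_real (s j) * u j $ i) *s c j)" for i
    by (simp add: row_def vec_eq_iff entry)
  then have "row i ?A \<in> vec.span (c ` I)" for i
    by (simp only:) (intro vec.span_sum vec.span_scale vec.span_base imageI)
  then have "rows ?A \<subseteq> vec.span (c ` I)"
    by (auto simp: rows_def)
  moreover have "c j \<in> vec.span (rows ?A)" if "j \<in> I" for j
  proof -
    have "(\<Sum>i\<in>UNIV. cnj (u j $ i) *s row i ?A) = of_real (s j) *s c j"
    proof (subst vec_eq_iff, intro allI)
      fix k
      have "(?A *v axis k 1) $ i = ?A $ i $ k" for i
        by (simp add: matrix_vector_mult_def axis_def if_distrib cong: if_cong)
      then have "(\<Sum>i\<in>UNIV. cnj (u j $ i) *s row i ?A) $ k = cinner (u j) (?A *v axis k 1)"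
        by (simp add: cinner_def row_def)
      also have "\<dots> = of_real (s j) * cinner (v j) (axis k 1)"
        using that by (simp add: cinner_dyads[OF assms(1,3)])
      also have "cinner (v j) (axis k 1) = c j $ k"
        by (simp add: cinner_def c_def axis_def if_distrib cong: if_cong)
      finally show "(\<Sum>i\<in>UNIV. cnj (u j $ i) *s row i ?A) $ k = (of_real (s j) *s c j) $ k"
        by simp
    qed
    moreover have "(\<Sum>i\<in>UNIV. cnj (u j $ i) *s row i ?A) \<in> vec.span (rows ?A)"
      by (intro vec.span_sum vec.span_scale vec.span_base) (auto simp: rows_def)
    ultimately have "inverse (of_real (s j)) *s (of_real (s j) *s c j) \<in> vec.span (rows ?A)"
      by (metis vec.span_scale)
    then show ?thesis
      using assms(4)[OF that] by simp
  qed
  ultimately have "vec.span (rows ?A) = vec.span (c ` I)"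
    by (intro vec.span_eq[THEN iffD2]) auto
  then have "vec.dim (rows ?A) = vec.dim (vec.span (c ` I))"
    by (metis vec.dim_span)
  then show ?thesis
    unfolding row_rank_def_gen dim_span_orthonormal[OF c assms(3)] .
qed

section \<open>Kernels and their projectors\<close>

lemma sol_dyads:
  assumes "orthonormal_on I u" "orthonormal_on I v" "finite I" "\<And>j. j \<in> I \<Longrightarrow> s j \<noteq> 0"
  shows "sol (dyads I s u v) = sol (orthoproj I v)"
proof -
  have "dyads I (\<lambda>j. inverse (s j)) v u ** dyads I s u v = orthoproj I v"
    "dyads I s u v ** orthoproj I v = dyads I s u v"
    using assms(4) by (auto simp: dyads_mult[OF assms(1,3)] dyads_mult[OF assms(2,3)]
        intro!: dyads_cong)
  then show ?thesis
    unfolding sol_def by (metis matrix_vector_mul_assoc matrix_vector_mult_0_right)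
qed

lemma is_projectorD:
  assumes "is_projector S M"
  shows "conj_transpose M = M" "M *v x \<in> S" "x \<in> S \<Longrightarrow> M *v x = x"
proof -
  obtain k p where p: "orthonormal_on {1..k} p" "vec.span (p ` {1..k}) = S"
    "M = orthoproj {1..k} p"
    using assms by (auto simp: is_projector_def dyads_def)
  show "conj_transpose M = M" "M *v x \<in> S" "x \<in> S \<Longrightarrow> M *v x = x"
    unfolding p(3) p(2)[symmetric]
    by (auto simp: conj_transpose_dyads orthoproj_mult_vec_in_span orthoproj_mult_vec_span[OF p(1)])
qed

text \<open>Each of two projectors for the same subspace fixes the range of the other, so
  \<open>M N = N\<close> and \<open>N M = M\<close>; taking adjoints gives \<open>N = M\<close>.\<close>

lemma projector_eq:
  assumes M: "is_projector S M"
  shows "projector S = M"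
  unfolding projector_def
proof (rule the_equality, rule M)
  fix N assume N: "is_projector S N"
  have "M ** N = N" "N ** M = M"
    using is_projectorD[OF M] is_projectorD[OF N]
    by (simp_all add: matrix_eq flip: matrix_vector_mul_assoc)
  then show "N = M"
    by (metis conj_transpose_mult is_projectorD(1)[OF M] is_projectorD(1)[OF N])
qed

text \<open>Completing \<open>v 1, \<dots>, v r\<close> to an orthonormal basis, the added \<open>n - r\<close> vectors form an orthonormal
  basis of the kernel.\<close>

lemma sol_orthoproj:
  fixes v :: "nat \<Rightarrow> complex^'n"
  assumes v: "orthonormal_on {1..r} v" and r: "r \<le> CARD('n)"
  shows "sol (orthoproj {1..r} v) \<in> grassmannian (CARD('n) - r)"
    and "projector (sol (orthoproj {1..r} v)) = mat 1 - orthoproj {1..r} v"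
proof -
  let ?P = "orthoproj {1..r} v" and ?J = "{1 + r..CARD('n)}"
  obtain w where w: "orthonormal_on {1..CARD('n)} w" "\<And>j. j \<in> {1..r} \<Longrightarrow> w j = v j"
    using orthonormal_extend[OF assms] by blast
  have "{1..CARD('n)} - {1..r} = ?J"
    using r by auto
  moreover have "orthoproj {1..r} w = ?P"
    using w(2) by (intro dyads_cong) auto
  ultimately have compl: "mat 1 - ?P = orthoproj ?J w"
    using dyads_diff[of "{1..CARD('n)}" "{1..r}" "\<lambda>_. 1" w w] r by (simp add: orthoproj_full[OF w(1)])
  have wJ: "orthonormal_on ?J w"
    by (rule orthonormal_on_subset[OF w(1)]) auto
  have iff: "x \<in> sol ?P \<longleftrightarrow> (mat 1 - ?P) *v x = x" for x
    by (simp add: sol_def matrix_vector_mult_diff_rdistrib)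
  have sol: "sol ?P = vec.span (w ` ?J)"
  proof (intro set_eqI iffI)
    fix x assume "x \<in> sol ?P"
    then show "x \<in> vec.span (w ` ?J)"
      unfolding iff compl by (metis orthoproj_mult_vec_in_span)
  next
    fix x assume "x \<in> vec.span (w ` ?J)"
    then show "x \<in> sol ?P"
      unfolding iff compl by (intro orthoproj_mult_vec_span wJ) auto
  qed
  have "vec.dim (sol ?P) = CARD('n) - r"
    unfolding sol dim_span_orthonormal[OF wJ finite_atLeastAtMost] by simp
  then show "sol ?P \<in> grassmannian (CARD('n) - r)"
    by (simp add: grassmannian_def subspace_sol)
  define p where "p j = w (j + r)" for j
  have J: "?J = (\<lambda>j. j + r) ` {1..CARD('n) - r}"
    using r by (simp add: image_add_atLeastAtMost')
  have "orthonormal_on {1..CARD('n) - r} p"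
    using wJ unfolding J by (auto simp: orthonormal_on_def p_def)
  moreover have "p ` {1..CARD('n) - r} = w ` ?J"
    unfolding J image_image by (rule image_cong) (simp_all add: p_def)
  moreover have "orthoproj ?J w = (\<Sum>j\<in>{1..CARD('n) - r}. outer (p j) (p j))"
    unfolding J dyads_def by (subst sum.reindex) (auto simp: p_def inj_on_def)
  ultimately have "is_projector (sol ?P) (mat 1 - ?P)"
    unfolding is_projector_def sol compl
    by (intro exI[of _ "CARD('n) - r"] exI[of _ p] conjI) simp_all
  then show "projector (sol ?P) = mat 1 - ?P"
    by (rule projector_eq)
qed

lemma gdist_sol_orthoproj:
  fixes v q :: "nat \<Rightarrow> complex^'n"
  assumes "orthonormal_on {1..r} v" "orthonormal_on {1..r} q" "r \<le> CARD('n)"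
  shows "gdist (sol (orthoproj {1..r} q)) (sol (orthoproj {1..r} v)) =
    spectral_norm (orthoproj {1..r} v - orthoproj {1..r} q)"
  unfolding gdist_def using assms by (simp add: sol_orthoproj)

section \<open>Numerical solutions\<close>

lemma atLeastAtMost_subset_sv_index:
  "{1..r} \<subseteq> sv_index (A :: complex^'n^'m) \<longleftrightarrow> r \<le> min CARD('m) CARD('n)"
  by (auto simp: sv_index_def)

text \<open>Since singular values decrease, those above a cutoff have an initial segment of
  indices.\<close>

lemma large_singular_values_initial:
  fixes A :: "complex^'n^'m"
  assumes A: "is_svd A \<sigma> u v"
  obtains r where "{j \<in> sv_index A. t < \<sigma> j} = {1..r}" "{1..r} \<subseteq> sv_index A"
proof -
  let ?S = "{j \<in> sv_index A. t < \<sigma> j}"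
  show thesis
  proof (cases "?S = {}")
    case True
    then show thesis
      using that[of 0] by simp
  next
    case False
    have "finite ?S"
      by simp
    then have max: "Max ?S \<in> ?S" "\<And>j. j \<in> ?S \<Longrightarrow> j \<le> Max ?S"
      using False by (auto simp del: mem_Collect_eq)
    have "j \<in> ?S" if "j \<in> {1..Max ?S}" for j
    proof -
      have "j \<in> sv_index A"
        using max(1) that by (auto simp: sv_index_def)
      moreover have "\<sigma> (Max ?S) \<le> \<sigma> j"
        using is_svdD(5)[OF A \<open>j \<in> sv_index A\<close>] max(1) that by auto
      ultimately show ?thesis
        using max(1) by auto
    qed
    moreover have "j \<in> {1..Max ?S}" if "j \<in> ?S" for j
      using max(2)[OF that] that by (auto simp: sv_index_def)
    ultimately have "?S = {1..Max ?S}"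
      by blast
    then show thesis
      using that[of "Max ?S"] by blast
  qed
qed

text \<open>Uniqueness of the \<open>\<theta>\<close>-projection: for two decompositions of the same matrix the perturbation
  in Wedin's theorem is zero while the gap at \<open>\<theta>\<close> is positive, so the projectors \<open>P\<close> of both
  decompositions coincide, and the truncations are both equal to \<open>A P\<close>.\<close>

lemma is_theta_projection_iff:
  fixes A :: "complex^'n^'m"
  assumes A: "is_svd A \<sigma> u v" and r: "{1..r} \<subseteq> sv_index A" and "0 < \<theta>"
    and gt: "\<And>j. j \<in> {1..r} \<Longrightarrow> \<theta> < \<sigma> j" and lt: "\<And>j. j \<in> sv_index A - {1..r} \<Longrightarrow> \<sigma> j < \<theta>"
  shows "is_theta_projection \<theta> A H \<longleftrightarrow> H = dyads {1..r} \<sigma> u v"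
proof
  have S: "{j \<in> sv_index A. \<theta> < \<sigma> j} = {1..r}"
    using r gt lt by (force intro!: set_eqI)
  have "\<sigma> j \<noteq> \<theta>" if "j \<in> sv_index A" for j
    using gt[of j] lt[of j] that by (cases "j \<in> {1..r}") auto
  then have "\<theta> \<notin> singular_values A"
    by (auto simp: singular_values_def singular_value_eq[OF A])
  then show "is_theta_projection \<theta> A H" if "H = dyads {1..r} \<sigma> u v"
    unfolding is_theta_projection_def using A \<open>0 < \<theta>\<close>
    by (intro conjI exI[of _ \<sigma>] exI[of _ u] exI[of _ v]) (simp_all add: S that dyads_def)
  assume "is_theta_projection \<theta> A H"
  then obtain \<tau> p q where B: "is_svd A \<tau> p q"
    and H: "H = dyads {j \<in> sv_index A. \<theta> < \<tau> j} \<tau> p q"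
    by (auto simp: is_theta_projection_def dyads_def)
  have eq: "\<tau> j = \<sigma> j" if "j \<in> sv_index A" for j
    using singular_value_eq[OF A that] singular_value_eq[OF B that] by simp
  then have "{j \<in> sv_index A. \<theta> < \<tau> j} = {j \<in> sv_index A. \<theta> < \<sigma> j}"
    by auto
  then have "H = dyads {1..r} \<tau> p q"
    using H S by simp
  then have H': "H = A ** orthoproj {1..r} q"
    by (simp add: svd_mult_orthoproj[OF B r])
  have "dyads {1..r} \<sigma> u v = A ** orthoproj {1..r} v"
    by (rule svd_mult_orthoproj[OF A r, symmetric])
  moreover have "orthoproj {1..r} v = orthoproj {1..r} q"
  proof -
    (* A lower bound for the singular values above the cutoff; any number above theta serves if there
       are none. *)
    define a where "a = (if r = 0 then \<theta> + 1 else \<sigma> r)"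
    have "a \<le> \<sigma> j" if "j \<in> {1..r}" for j
      using that is_svdD(5)[OF A, of j r] r by (auto simp: a_def subset_iff)
    moreover have "\<theta> < a"
      using gt by (auto simp: a_def)
    moreover have "\<sigma> j \<le> \<theta>" if "j \<in> sv_index A - {1..r}" for j
      using lt[OF that] by simp
    ultimately have "spectral_norm (orthoproj {1..r} v - orthoproj {1..r} q)
        \<le> spectral_norm (A - A) / (a - \<theta>)"
      using eq r \<open>0 < \<theta>\<close>
      by (intro orthoproj_perturbation[OF A B r, of a \<theta> a \<theta>]) (auto simp: subset_iff)
    also have "spectral_norm (A - A) = 0"
      by (simp add: spectral_norm_eq_0)
    finally show ?thesis
      using spectral_norm_nonneg[of "orthoproj {1..r} v - orthoproj {1..r} q"]
        spectral_norm_eq_0[of "orthoproj {1..r} v - orthoproj {1..r} q"] by simp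
  qed
  ultimately show "H = dyads {1..r} \<sigma> u v"
    using H' by simp
qed

lemma num_sol_truncation:
  fixes A :: "complex^'n^'m"
  assumes A: "is_svd A \<sigma> u v" and r: "{1..r} \<subseteq> sv_index A" and "0 < \<theta>"
    and gt: "\<forall>j\<in>{1..r}. \<theta> < \<sigma> j" and lt: "\<forall>j\<in>sv_index A - {1..r}. \<sigma> j < \<theta>"
  shows "num_sol_well_defined \<theta> A" "theta_projection \<theta> A = dyads {1..r} \<sigma> u v"
    "num_sol \<theta> A = sol (dyads {1..r} \<sigma> u v)" "numerical_rank \<theta> A = r"
proof -
  have proj: "is_theta_projection \<theta> A H \<longleftrightarrow> H = dyads {1..r} \<sigma> u v" for H
    using assms by (intro is_theta_projection_iff) auto
  then show "num_sol_well_defined \<theta> A" "theta_projection \<theta> A = dyads {1..r} \<sigma> u v"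
    "num_sol \<theta> A = sol (dyads {1..r} \<sigma> u v)"
    by (simp_all add: num_sol_well_defined_def theta_projection_def num_sol_def is_num_sol_def)
  have "{j \<in> sv_index A. \<theta> < singular_value A j} = {1..r}"
    using r gt lt by (force simp: singular_value_eq[OF A])
  then show "numerical_rank \<theta> A = r"
    by (simp add: numerical_rank_def)
qed

lemma sol_truncation:
  fixes A :: "complex^'n^'m"
  assumes "is_svd A \<sigma> u v" "{1..r} \<subseteq> sv_index A" "\<forall>j\<in>{1..r}. 0 < \<sigma> j"
  shows "orthonormal_on {1..r} u" "orthonormal_on {1..r} v" "r \<le> CARD('n)"
    "sol (dyads {1..r} \<sigma> u v) = sol (orthoproj {1..r} v)"
    "sol (dyads {1..r} \<sigma> u v) \<in> grassmannian (CARD('n) - r)"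
proof -
  show uv: "orthonormal_on {1..r} u" "orthonormal_on {1..r} v"
    using is_svdD[OF assms(1)] assms(2) orthonormal_on_subset by blast+
  show "r \<le> CARD('n)"
    using assms(2) unfolding atLeastAtMost_subset_sv_index by simp
  then show "sol (dyads {1..r} \<sigma> u v) = sol (orthoproj {1..r} v)"
    "sol (dyads {1..r} \<sigma> u v) \<in> grassmannian (CARD('n) - r)"
    using sol_dyads[OF uv finite_atLeastAtMost, of \<sigma>] sol_orthoproj[OF uv(2)] assms(3)
    by fastforce+
qed

text \<open>By Weyl's inequality the first \<open>r\<close> singular values of \<open>A + E\<close> stay above \<open>\<alpha> - \<parallel>E\<parallel> > \<theta>\<close> and the
  others below \<open>\<beta> + \<parallel>E\<parallel> < \<theta>\<close>. So the cutoff index is still \<open>r\<close>, and the gaps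
  \<open>\<alpha> - (\<beta> + \<parallel>E\<parallel>)\<close> and \<open>(\<alpha> - \<parallel>E\<parallel>) - \<beta>\<close> for the two directions of Wedin's theorem are equal.\<close>

lemma num_sol_perturbation:
  fixes A E :: "complex^'n^'m"
  assumes A: "is_svd A \<sigma> u v" and r: "{1..r} \<subseteq> sv_index A"
    and \<alpha>: "\<forall>j\<in>{1..r}. \<alpha> \<le> \<sigma> j"
    and \<beta>: "0 \<le> \<beta>" "\<forall>j\<in>sv_index A - {1..r}. \<sigma> j \<le> \<beta>"
    and E: "\<beta> + spectral_norm E < \<theta>" "\<theta> < \<alpha> - spectral_norm E"
  shows "num_sol_well_defined \<theta> (A + E)"
    and "num_sol \<theta> (A + E) \<in> grassmannian (CARD('n) - r)"
    and "gdist (num_sol \<theta> (A + E)) (sol (dyads {1..r} \<sigma> u v)) \<le>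
      spectral_norm E / (\<alpha> - \<beta> - spectral_norm E)"
proof -
  define e where "e = spectral_norm E"
  have e: "0 \<le> e" "e = spectral_norm (A - (A + E))" "e = spectral_norm (A + E - A)"
    using spectral_norm_minus_commute[of A "A + E"] by (simp_all add: e_def spectral_norm_nonneg)
  obtain \<tau> p q where B: "is_svd (A + E) \<tau> p q"
    using exists_svd by blast
  have D: "sv_index (A + E) = sv_index A"
    by (simp add: sv_index_def)
  have \<tau>: "\<alpha> - e \<le> \<tau> j" if "j \<in> {1..r}" for j
    using weyl_inequality[OF A B, of j] bspec[OF \<alpha> that] r that e by auto
  have \<tau>': "\<tau> j \<le> \<beta> + e" if "j \<in> sv_index A - {1..r}" for j
    using weyl_inequality[OF B A, of j] bspec[OF \<beta>(2) that] that e D by auto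
  have \<theta>: "\<beta> + e < \<theta>" "\<theta> < \<alpha> - e" "0 < \<theta>"
    using E \<beta>(1) \<open>0 \<le> e\<close> by (auto simp: e_def)
  have pos: "0 < \<sigma> j \<and> 0 < \<tau> j \<and> \<theta> < \<tau> j" if "j \<in> {1..r}" for j
    using bspec[OF \<alpha> that] \<tau>[OF that] \<theta> \<open>0 \<le> e\<close> by linarith
  then have pos: "\<forall>j\<in>{1..r}. 0 < \<sigma> j" "\<forall>j\<in>{1..r}. 0 < \<tau> j" "\<forall>j\<in>{1..r}. \<theta> < \<tau> j"
    by auto
  have "\<forall>j\<in>sv_index (A + E) - {1..r}. \<tau> j < \<theta>"
    using \<tau>' \<theta>(1) unfolding D by fastforce
  note B_trunc = num_sol_truncation[OF B r[folded D] \<theta>(3) pos(3) this]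
  note dA = sol_truncation[OF A r pos(1)] and dB = sol_truncation[OF B r[folded D] pos(2)]
  show "num_sol_well_defined \<theta> (A + E)" "num_sol \<theta> (A + E) \<in> grassmannian (CARD('n) - r)"
    using dB(5) by (simp_all add: B_trunc(1,3))
  have "gdist (num_sol \<theta> (A + E)) (sol (dyads {1..r} \<sigma> u v)) =
      spectral_norm (orthoproj {1..r} v - orthoproj {1..r} q)"
    unfolding B_trunc(3) dA(4) dB(4) by (rule gdist_sol_orthoproj) (use dA dB in auto)
  also have "\<dots> \<le> spectral_norm (A - (A + E)) / (\<alpha> - \<beta> - e)"
    by (rule orthoproj_perturbation[OF A B r, where a = \<alpha> and b = \<beta> and a' = "\<alpha> - e" and b' = "\<beta> + e"])
      (use \<alpha> \<beta> \<tau> \<tau>' \<theta> \<open>0 \<le> e\<close> in auto)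
  finally show "gdist (num_sol \<theta> (A + E)) (sol (dyads {1..r} \<sigma> u v)) \<le>
      spectral_norm E / (\<alpha> - \<beta> - spectral_norm E)"
    using e(2) by (simp add: e_def)
qed

lemma well_defined_cutoff:
  fixes A :: "complex^'n^'m"
  assumes A: "is_svd A \<sigma> u v" and "num_sol_well_defined \<theta> A"
  obtains r where "{1..r} \<subseteq> sv_index A" "\<forall>j\<in>{1..r}. \<theta> < \<sigma> j"
    "\<forall>j\<in>sv_index A - {1..r}. \<sigma> j < \<theta>"
proof -
  have "\<theta> \<notin> singular_values A"
    using assms(2) by (auto simp: num_sol_well_defined_def is_num_sol_def is_theta_projection_def)
  then have ne: "\<sigma> j \<noteq> \<theta>" if "j \<in> sv_index A" for j
    using that singular_value_eq[OF A that] unfolding singular_values_def by (metis imageI)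
  obtain r where r: "{j \<in> sv_index A. \<theta> < \<sigma> j} = {1..r}" "{1..r} \<subseteq> sv_index A"
    using large_singular_values_initial[OF A] .
  show thesis
  proof (rule that[OF r(2)])
    show "\<forall>j\<in>{1..r}. \<theta> < \<sigma> j"
      unfolding r(1)[symmetric] by simp
    show "\<forall>j\<in>sv_index A - {1..r}. \<sigma> j < \<theta>"
      using ne unfolding r(1)[symmetric] by fastforce
  qed
qed

text \<open>For the truncation \<open>T\<close>, the norms in the theorem are singular values: \<open>\<parallel>T\<parallel> = \<sigma> 1 = \<parallel>A\<parallel>\<close>,
  \<open>\<parallel>T\<^sup>\<dagger>\<parallel> = 1 / \<sigma> r\<close>, and \<open>\<parallel>A - T\<parallel>\<close> bounds the discarded singular values.\<close>

lemma spectral_norms_truncation: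
  fixes A :: "complex^'n^'m"
  assumes A: "is_svd A \<sigma> u v" and r: "{1..r} \<subseteq> sv_index A" "1 \<le> r" and "0 < \<sigma> r"
  shows "spectral_norm (dyads {1..r} \<sigma> u v) = spectral_norm A"
    "spectral_norm (pinv (dyads {1..r} \<sigma> u v)) = inverse (\<sigma> r)" "0 < spectral_norm A"
    "\<forall>j\<in>{1..r}. \<sigma> r \<le> \<sigma> j"
    "\<forall>j\<in>sv_index A - {1..r}. \<sigma> j \<le> spectral_norm (A - dyads {1..r} \<sigma> u v)"
proof -
  note svd = is_svdD[OF A]
  have ge: "\<sigma> r \<le> \<sigma> j" if "j \<in> {1..r}" for j
    using that svd(5)[of j r] r by (auto simp: subset_iff)
  then show "\<forall>j\<in>{1..r}. \<sigma> r \<le> \<sigma> j"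
    by blast
  have uv: "orthonormal_on {1..r} u" "orthonormal_on {1..r} v"
    using svd r orthonormal_on_subset by blast+
  have one: "1 \<in> sv_index A" "1 \<in> {1..r}"
    using r by auto
  have top: "0 \<le> \<sigma> j \<and> \<sigma> j \<le> \<sigma> 1" if "j \<in> sv_index A" for j
    using svd(4)[OF that] svd(5)[OF one(1) that] that by (auto simp: sv_index_def)
  have nA: "spectral_norm A = \<sigma> 1"
    by (subst svd(1)) (rule spectral_norm_dyads, use svd(2,3) one(1) top in auto)
  also have "\<sigma> 1 = spectral_norm (dyads {1..r} \<sigma> u v)"
    using top r by (intro spectral_norm_dyads[symmetric] uv one) auto
  finally show "spectral_norm (dyads {1..r} \<sigma> u v) = spectral_norm A" ..
  show "0 < spectral_norm A"
    using ge[OF one(2)] \<open>0 < \<sigma> r\<close> by (simp add: nA)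
  have "0 < \<sigma> j" if "j \<in> {1..r}" for j
    using ge[OF that] \<open>0 < \<sigma> r\<close> by simp
  then have "pinv (dyads {1..r} \<sigma> u v) = dyads {1..r} (\<lambda>j. inverse (\<sigma> j)) v u"
    by (intro pinv_dyads uv) fastforce+
  moreover have "spectral_norm (dyads {1..r} (\<lambda>j. inverse (\<sigma> j)) v u) = inverse (\<sigma> r)"
    using r(2) ge \<open>\<And>j. j \<in> {1..r} \<Longrightarrow> 0 < \<sigma> j\<close> \<open>0 < \<sigma> r\<close>
    by (intro spectral_norm_dyads uv) (auto intro: le_imp_inverse_le less_imp_le)
  ultimately show "spectral_norm (pinv (dyads {1..r} \<sigma> u v)) = inverse (\<sigma> r)"
    by simp
  have "\<sigma> j \<le> spectral_norm (A - dyads {1..r} \<sigma> u v)" if j: "j \<in> sv_index A - {1..r}" for j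
  proof -
    have "A - dyads {1..r} \<sigma> u v = dyads (sv_index A - {1..r}) \<sigma> u v"
      by (subst svd(1)) (simp add: dyads_diff r)
    moreover have "orthonormal_on (sv_index A - {1..r}) u" "orthonormal_on (sv_index A - {1..r}) v"
      using orthonormal_on_subset[OF svd(2)] orthonormal_on_subset[OF svd(3)] by blast+
    ultimately show ?thesis
      using spectral_norm_dyads_ge[OF _ _ _ j, of u v \<sigma>] by simp
  qed
  then show "\<forall>j\<in>sv_index A - {1..r}. \<sigma> j \<le> spectral_norm (A - dyads {1..r} \<sigma> u v)"
    by blast
qed

text \<open>The compact decomposition: cutting off at zero changes nothing.\<close>

lemma full_truncation:
  fixes A :: "complex^'n^'m"
  assumes A: "is_svd A \<sigma> u v" and "A \<noteq> 0"
  obtains r where "{1..r} \<subseteq> sv_index A" "1 \<le> r" "0 < \<sigma> r" "A = dyads {1..r} \<sigma> u v" "rank A = r"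
    "\<And>j. j \<in> sv_index A - {1..r} \<Longrightarrow> \<sigma> j = 0"
proof -
  note svd = is_svdD[OF A]
  obtain r where r: "{j \<in> sv_index A. 0 < \<sigma> j} = {1..r}" "{1..r} \<subseteq> sv_index A"
    using large_singular_values_initial[OF A] .
  have pos: "0 < \<sigma> j" if "j \<in> {1..r}" for j
    using that unfolding r(1)[symmetric] by simp
  have zero: "\<sigma> j = 0" if "j \<in> sv_index A - {1..r}" for j
    using that svd(4)[of j] unfolding r(1)[symmetric] by auto
  have "A - dyads {1..r} \<sigma> u v = dyads (sv_index A - {1..r}) \<sigma> u v"
    by (subst svd(1)) (simp add: dyads_diff r)
  also have "\<dots> = 0"
    using zero by (simp add: dyads_def)
  finally have eq: "A = dyads {1..r} \<sigma> u v"
    by simp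
  have "r \<noteq> 0"
    using eq \<open>A \<noteq> 0\<close> by (intro notI) (simp add: dyads_def)
  moreover have "rank (dyads {1..r} \<sigma> u v) = r"
    using orthonormal_on_subset[OF svd(2) r(2)] orthonormal_on_subset[OF svd(3) r(2)] pos
    by (subst rank_dyads) (auto simp: less_le)
  ultimately show thesis
    using that[OF r(2)] pos zero eq by auto
qed

text \<open>Part (ii). With \<open>\<alpha> = \<parallel>T\<^sup>\<dagger>\<parallel>\<^sup>-\<^sup>1\<close> and \<open>\<beta> = \<parallel>A - T\<parallel>\<close>, the two bounds
  on \<open>\<Delta>A\<close> place \<open>\<theta>\<close> strictly between \<open>\<beta> + \<parallel>\<Delta>A\<parallel>\<close> and \<open>\<alpha> - \<parallel>\<Delta>A\<parallel>\<close>, so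
  the gap \<open>\<alpha> - \<beta> - \<parallel>\<Delta>A\<parallel>\<close> in the denominator is positive.\<close>

lemma num_sol_perturbation_theta_projection:
  fixes A \<Delta>A :: "complex^'n^'m"
  assumes "0 < \<theta>" "num_sol_well_defined \<theta> A" and T: "T = theta_projection \<theta> A" "T \<noteq> 0"
    and \<Delta>: "spectral_norm \<Delta>A < \<theta> - spectral_norm (A - T)"
      "spectral_norm \<Delta>A < inverse (spectral_norm (pinv T)) - \<theta>"
  shows "num_sol_well_defined \<theta> (A + \<Delta>A)"
    and "num_sol \<theta> A \<in> grassmannian (CARD('n) - numerical_rank \<theta> A)"
    and "num_sol \<theta> (A + \<Delta>A) \<in> grassmannian (CARD('n) - numerical_rank \<theta> A)"
    and "gdist (num_sol \<theta> (A + \<Delta>A)) (num_sol \<theta> A)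
      \<le> spectral_norm T * spectral_norm (pinv T)
          / (1 - spectral_norm (pinv T) * (spectral_norm (A - T) + spectral_norm \<Delta>A))
          * (spectral_norm \<Delta>A / spectral_norm A)"
proof -
  obtain \<sigma> u v where A: "is_svd A \<sigma> u v"
    using exists_svd by blast
  obtain r where r: "{1..r} \<subseteq> sv_index A" "\<forall>j\<in>{1..r}. \<theta> < \<sigma> j"
    "\<forall>j\<in>sv_index A - {1..r}. \<sigma> j < \<theta>"
    using well_defined_cutoff[OF A assms(2)] by blast
  note trunc = num_sol_truncation[OF A r(1) \<open>0 < \<theta>\<close> r(2,3)]
  have T_eq: "T = dyads {1..r} \<sigma> u v"
    by (simp add: T trunc)
  have "r \<noteq> 0"
    using T(2) unfolding T_eq by (intro notI) (simp add: dyads_def)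
  then have "1 \<le> r" "0 < \<sigma> r"
    using bspec[OF r(2), of r] \<open>0 < \<theta>\<close> by auto
  note norms = spectral_norms_truncation[OF A r(1) this, folded T_eq]
  have E: "spectral_norm (A - T) + spectral_norm \<Delta>A < \<theta>" "\<theta> < \<sigma> r - spectral_norm \<Delta>A"
    using \<Delta> by (simp_all add: norms)
  note pert = num_sol_perturbation[OF A r(1) norms(4) spectral_norm_nonneg norms(5) E]
  have "\<forall>j\<in>{1..r}. 0 < \<sigma> j"
    using r(2) \<open>0 < \<theta>\<close> by force
  note dy = sol_truncation[OF A r(1) this]
  show "num_sol_well_defined \<theta> (A + \<Delta>A)"
    "num_sol \<theta> A \<in> grassmannian (CARD('n) - numerical_rank \<theta> A)"
    "num_sol \<theta> (A + \<Delta>A) \<in> grassmannian (CARD('n) - numerical_rank \<theta> A)"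
    using pert dy(5) by (simp_all add: trunc)
  define \<beta> e where "\<beta> = spectral_norm (A - T)" and "e = spectral_norm \<Delta>A"
  have "\<beta> + e < \<sigma> r"
    using E spectral_norm_nonneg[of \<Delta>A] by (simp add: \<beta>_def e_def)
  then have "e / (\<sigma> r - \<beta> - e) = spectral_norm A * inverse (\<sigma> r)
      / (1 - inverse (\<sigma> r) * (\<beta> + e)) * (e / spectral_norm A)"
    using norms(3) \<open>0 < \<sigma> r\<close> by (simp add: divide_simps)
  then show "gdist (num_sol \<theta> (A + \<Delta>A)) (num_sol \<theta> A)
      \<le> spectral_norm T * spectral_norm (pinv T)
          / (1 - spectral_norm (pinv T) * (spectral_norm (A - T) + spectral_norm \<Delta>A))
          * (spectral_norm \<Delta>A / spectral_norm A)"
    using pert(3) unfolding norms(1,2) trunc(3) \<beta>_def e_def by linarith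
qed

text \<open>Part (i): no positive singular value lies below \<open>\<theta>\<close>, so nothing is cut off.\<close>

lemma num_sol_below_smallest_singular_value:
  fixes A :: "complex^'n^'m"
  assumes "A \<noteq> 0" "0 < \<theta>" "\<theta> < inverse (spectral_norm (pinv A))"
  shows "num_sol_well_defined \<theta> A" "theta_projection \<theta> A = A" "num_sol \<theta> A = sol A"
    "numerical_rank \<theta> A = rank A"
proof -
  obtain \<sigma> u v where A: "is_svd A \<sigma> u v"
    using exists_svd by blast
  obtain r where r: "{1..r} \<subseteq> sv_index A" "1 \<le> r" "0 < \<sigma> r" "A = dyads {1..r} \<sigma> u v" "rank A = r"
    "\<And>j. j \<in> sv_index A - {1..r} \<Longrightarrow> \<sigma> j = 0"
    using full_truncation[OF A assms(1)] by blast
  note norms = spectral_norms_truncation[OF A r(1-3), folded r(4)]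
  have "\<theta> < \<sigma> r"
    using assms(3) by (simp add: norms)
  then have "\<forall>j\<in>{1..r}. \<theta> < \<sigma> j"
    using norms(4) by force
  then show "num_sol_well_defined \<theta> A" "theta_projection \<theta> A = A" "num_sol \<theta> A = sol A"
    "numerical_rank \<theta> A = rank A"
    using num_sol_truncation[OF A r(1) assms(2), folded r(4)] r(5,6) assms(2) by simp_all
qed

section \<open>The perturbation theorem\<close>

theorem theorem1:
  fixes A :: "complex^'n^'m"
  assumes "A \<noteq> 0"
  shows
    "(\<forall>\<theta>. 0 < \<theta> \<and> \<theta> < inverse (spectral_norm (pinv A)) \<longrightarrow>
        num_sol_well_defined \<theta> A \<and> sol A = num_sol \<theta> A) \<and>
     (\<forall>\<theta>>0. num_sol_well_defined \<theta> A \<and> theta_projection \<theta> A \<noteq> 0 \<longrightarrow>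
        (\<forall>\<Delta>A :: complex^'n^'m.
           spectral_norm \<Delta>A <
             min ((inverse (spectral_norm (pinv (theta_projection \<theta> A)))
                     - spectral_norm (A - theta_projection \<theta> A)) / 2)
               (min (\<theta> - spectral_norm (A - theta_projection \<theta> A))
                    (inverse (spectral_norm (pinv (theta_projection \<theta> A))) - \<theta>)) \<longrightarrow>
           num_sol_well_defined \<theta> (A + \<Delta>A) \<and>
           num_sol \<theta> A \<in> grassmannian (CARD('n) - numerical_rank \<theta> A) \<and>
           num_sol \<theta> (A + \<Delta>A) \<in> grassmannian (CARD('n) - numerical_rank \<theta> A) \<and>
           gdist (num_sol \<theta> (A + \<Delta>A)) (num_sol \<theta> A)
             \<le> spectral_norm (theta_projection \<theta> A) * spectral_norm (pinv (theta_projection \<theta> A))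
                 / (1 - spectral_norm (pinv (theta_projection \<theta> A))
                        * (spectral_norm (A - theta_projection \<theta> A) + spectral_norm \<Delta>A))
                 * (spectral_norm \<Delta>A / spectral_norm A))) \<and>
     (\<forall>\<Delta>A :: complex^'n^'m.
        spectral_norm \<Delta>A < inverse (spectral_norm (pinv A)) / 2 \<longrightarrow>
        (\<exists>\<mu> \<eta>. \<mu> \<ge> 0 \<and> \<eta> > 0 \<and>
           \<mu> \<le> spectral_norm \<Delta>A \<and>
           spectral_norm \<Delta>A < inverse (spectral_norm (pinv A)) - spectral_norm \<Delta>A \<and>
           inverse (spectral_norm (pinv A)) - spectral_norm \<Delta>A \<le> \<eta> \<and>
           (\<forall>\<theta>. \<mu> < \<theta> \<and> \<theta> < \<eta> \<longrightarrow>
              num_sol_well_defined \<theta> (A + \<Delta>A) \<and>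
              sol A \<in> grassmannian (CARD('n) - rank A) \<and>
              num_sol \<theta> (A + \<Delta>A) \<in> grassmannian (CARD('n) - rank A) \<and>
              gdist (num_sol \<theta> (A + \<Delta>A)) (sol A)
                \<le> spectral_norm A * spectral_norm (pinv A)
                    / (1 - spectral_norm (pinv A) * spectral_norm \<Delta>A)
                    * (spectral_norm \<Delta>A / spectral_norm A))))"
proof (intro conjI allI impI, goal_cases)
  case (1 \<theta>)
  then show ?case
    using num_sol_below_smallest_singular_value(1)[OF assms] by blast
next
  case (2 \<theta>)
  then show ?case
    using num_sol_below_smallest_singular_value(3)[OF assms] by simp
next
  case (3 \<theta> \<Delta>A)
  then show ?case
    by (intro num_sol_perturbation_theta_projection(1)[OF _ _ refl]) auto
next
  case (4 \<theta> \<Delta>A)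
  then show ?case
    by (intro num_sol_perturbation_theta_projection(2)[OF _ _ refl, where \<Delta>A = \<Delta>A]) auto
next
  case (5 \<theta> \<Delta>A)
  then show ?case
    by (intro num_sol_perturbation_theta_projection(3)[OF _ _ refl]) auto
next
  case (6 \<theta> \<Delta>A)
  then show ?case
    by (intro num_sol_perturbation_theta_projection(4)[OF _ _ refl]) auto
next
  case (7 \<Delta>A)
  (* For theta between these bounds, the hypotheses of part (ii) hold because A is its own
     theta-projection. *)
  show ?case
  proof (rule exI[of _ "spectral_norm \<Delta>A"],
      rule exI[of _ "inverse (spectral_norm (pinv A)) - spectral_norm \<Delta>A"],
      intro conjI allI impI)
    show "0 \<le> spectral_norm \<Delta>A"
      by (rule spectral_norm_nonneg)
    then show "0 < inverse (spectral_norm (pinv A)) - spectral_norm \<Delta>A"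
      "spectral_norm \<Delta>A < inverse (spectral_norm (pinv A)) - spectral_norm \<Delta>A"
      using 7 by linarith+
    fix \<theta> assume \<theta>: "spectral_norm \<Delta>A < \<theta> \<and> \<theta> < inverse (spectral_norm (pinv A)) - spectral_norm \<Delta>A"
    then have "0 < \<theta>" "\<theta> < inverse (spectral_norm (pinv A))"
      using \<open>0 \<le> spectral_norm \<Delta>A\<close> by linarith+
    note exact = num_sol_below_smallest_singular_value[OF assms this]
    have zero: "spectral_norm (A - A) = 0"
      by (simp add: spectral_norm_eq_0)
    have "spectral_norm \<Delta>A < \<theta> - spectral_norm (A - A)"
      "spectral_norm \<Delta>A < inverse (spectral_norm (pinv A)) - \<theta>"
      using \<theta> zero by simp_all
    note pert = num_sol_perturbation_theta_projection
      [OF \<open>0 < \<theta>\<close> exact(1) exact(2)[symmetric] assms this, unfolded exact zero add_0_left]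
    show "num_sol_well_defined \<theta> (A + \<Delta>A)" "sol A \<in> grassmannian (CARD('n) - rank A)"
      "num_sol \<theta> (A + \<Delta>A) \<in> grassmannian (CARD('n) - rank A)"
      "gdist (num_sol \<theta> (A + \<Delta>A)) (sol A)
        \<le> spectral_norm A * spectral_norm (pinv A)
            / (1 - spectral_norm (pinv A) * spectral_norm \<Delta>A)
            * (spectral_norm \<Delta>A / spectral_norm A)"
      by (fact pert)+
  qed simp_all
qed

end
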